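(* Let $\mathcal{E}_r=\mathcal{F}_\sigma M_{\sigma,R}\mathcal{F}_\sigma^T$ and $\mathcal{A}_r(x_r)=-\mathcal{F}_\nu M_\nu(\mathcal{F}_\nu^Tx_r)\mathcal{F}_\nu^T$ for $x_r\in\mathbb{R}^{n_r}$, where $$\mathcal{F}_\sigma=\begin{bmatrix}I_{n_1}&X_1\\ 0&\hat{Y}_{C_2}^TX_2\end{bmatrix},\qquad M_{\sigma,R}=\begin{bmatrix}M_{11}&0\\ 0&R^{-1}\end{bmatrix},\qquad \mathcal{F}_\nu=\begin{bmatrix}C_1^T\\ \hat{Y}_{C_2}^TC_2^T\end{bmatrix}.$$ Then there exists a nonsingular constant (i.e. independent of $x_r$) matrix $W\in\mathbb{R}^{n_r\times n_r}$ such that $$W^T\mathcal{E}_rW=\begin{bmatrix}E_{11}&0&0\\ 0&I_{n_0}&0\\ 0&0&0\end{bmatrix},\qquad W^T\mathcal{A}_r(x_r)W=\begin{bmatrix}A_{11}(x_r)&0&0\\ 0&0&0\\ 0&0&-I_{n_\infty}\end{bmatrix},$$ where $E_{11}\in\mathbb{R}^{n_s\times n_s}$ and $-A_{11}(x_r)\in\mathbb{R}^{n_s\times n_s}$ are both symmetric and positive definite, and $n_s+n_0+n_\infty=n_r$.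
   Context: All spaces are real; $\|\cdot\|$ is the Euclidean norm. Domain and data. $\Omega\subset\mathbb{R}^3$ is a simply connected bounded Lipschitz domain, decomposed into a conducting subdomain $\Omega_C$ (connected, $\overline{\Omega}_C\subset\Omega$) and a non-conducting subdomain $\Omega_I=\Omega\setminus\overline{\Omega}_C$; $\Omega_I$ has finitely many connected internal subdomains with single boundary components $\Gamma_1,\ldots,\Gamma_q$ and an external subdomain $\Omega_{I,\rm ext}$ with two boundary components $\Gamma_{\rm ext}=\overline{\Omega}_{I,\rm ext}\cap\overline{\Omega}_C$ and $\partial\Omega$. The conductivity is $\sigma=\sigma_C\mathbb{1}_{\Omega_C}$ with $\sigma_C>0$. The reluctivity is $\nu(\xi,\zeta)=\nu_C(\zeta)\mathbb{1}_{\Omega_C}(\xi)+\nu_I\mathbb{1}_{\Omega_I}(\xi)$, where $\nu_I>0$ and $\nu_C:\mathbb{R}_{\ge0}\to\mathbb{R}_{\ge0}$ is measurable, and $\zeta\mapsto\nu_C(\zeta)\zeta$ is strongly monotone with constant $m_{\nu_C}>0$ and Lipschitz continuous with constant $L_{\nu_C}>0$. The resistance matrix $R\in\mathbb{R}^{m\times m}$ is symmetric positive definite. The winding function $\chi=[\chi_1,\ldots,\chi_m]$ has columns $\chi_j\in L^2(\Omega;\mathbb{R}^3)$ with $\nabla\cdot\chi_j=0$ and pairwise disjoint supports; $\gamma_j$ are functions with components in $H^1(\Omega)$ and $\chi_j=\nabla\times\gamma_j$. FEM matrices. $\varphi_1^e,\ldots,\varphi_{n_e}^e\in H_0(\mathrm{curl},\Omega)$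 are the edge (Nédélec, first type) basis functions and $\varphi_1^f,\ldots,\varphi_{n_f}^f$ the face basis functions of a regular simplicial triangulation of $\Omega$. $C_d\in\mathbb{R}^{n_f\times n_e}$ is the discrete curl matrix, with $(C_d)_{kj}=\pm1$ if edge $j$ belongs to face $k$ with the same/opposite orientation, and $0$ otherwise. For $a=[\alpha_1^e,\ldots,\alpha_{n_e}^e]^T$ put $(M_\sigma)_{kl}=\int_\Omega\sigma\,\varphi_l^e\cdot\varphi_k^e\,{\rm d}\xi$, $(K(a))_{kl}=\int_\Omega\nu(\xi,\|\nabla\times\sum_j\alpha_j^e\varphi_j^e\|)(\nabla\times\varphi_l^e)\cdot(\nabla\times\varphi_k^e)\,{\rm d}\xi$, $X_{kj}=\int_\Omega\chi_j\cdot\varphi_k^e\,{\rm d}\xi$. They factor as $K(a)=C_d^TM_\nu(C_d\,a)C_d$ and $X=C_d^T\Upsilon$, where, with $C_d\,a=[\alpha_1^f,\ldots,\alpha_{n_f}^f]^T$, $(M_\nu(C_d\,a))_{kl}=\int_\Omega\nu(\xi,\|\sum_j\alpha_j^f\varphi_j^f\|)\varphi_l^f\cdot\varphi_k^f\,{\rm d}\xi$ and $\Upsilon_{kj}=\int_\Omega\gamma_j\cdot\varphi_k^f\,{\rm d}\xi$; $M_\nu(C_d\,a)$ is symmetric positive definite for all $a$. Ordering the edge basis functions according to the conducting and non-conducting subdomains gives partitions $a=[a_1^T,a_2^T]^T$ with $a_1\in\mathbb{R}^{n_1}$, $a_2\in\mathbb{R}^{n_2}$, $n_e=n_1+n_2$,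 $C_d=[C_1\ C_2]$, and $$M_\sigma=\begin{bmatrix}M_{11}&0\\ 0&0\end{bmatrix},\quad K(a)=\begin{bmatrix}K_{11}(a_1)&K_{12}\\ K_{21}&K_{22}\end{bmatrix},\quad X=\begin{bmatrix}X_1\\ X_2\end{bmatrix}=\begin{bmatrix}C_1^T\Upsilon\\ C_2^T\Upsilon\end{bmatrix},$$ where only $K_{11}(a_1)$ depends on $a$ (through $a_1$), $K_{12}$, $K_{21}=K_{12}^T$, $K_{22}$ are constant, $M_{11}$ is symmetric positive definite, and $X_2\in\mathbb{R}^{n_2\times m}$ has full column rank. Let $k_2=\dim\ker(C_2)$; the columns of $\hat{Y}_{C_2}\in\mathbb{R}^{n_2\times(n_2-k_2)}$ form a basis of $\mathrm{im}(C_2^T)$, and $n_r=n_1+n_2-k_2$. Write $x_r=[a_1^T,a_{21}^T]^T$ with $a_1\in\mathbb{R}^{n_1}$, $a_{21}\in\mathbb{R}^{n_2-k_2}$. In block form, $$\mathcal{A}_r(x_r)=-\begin{bmatrix} K_{11}(a_1) & K_{12}\hat{Y}_{C_2}\\ \hat{Y}_{C_2}^TK_{21} & \hat{Y}_{C_2}^TK_{22}\hat{Y}_{C_2}\end{bmatrix},$$ so only the upper left block depends on $x_r$. *)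

theory Defs
  imports "HOL-Analysis.Analysis" "Jordan_Normal_Form.DL_Rank" "Jordan_Normal_Form.Matrix_Kernel"
    "Jordan_Normal_Form.Gauss_Jordan_Elimination"
begin

text \<open>Euclidean space is the type \<open>real ^ 3\<close>; the finite element matrices, whose sizes depend on the
  mesh, are matrices with explicit carriers. Integrals are Lebesgue integrals, and functions on a
  domain \<open>\<Omega>\<close> are total functions whose values outside \<open>\<Omega>\<close> are never used.\<close>

type_synonym point = "real ^ 3"
type_synonym vfield = "real ^ 3 \<Rightarrow> real ^ 3"

section \<open>Function spaces\<close>

definition partial :: "3 \<Rightarrow> (point \<Rightarrow> real) \<Rightarrow> point \<Rightarrow> real" where
  "partial i f x = frechet_derivative f (at x) (axis i 1)"

definition grad :: "(point \<Rightarrow> real) \<Rightarrow> vfield" where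
  "grad f x = (\<chi> i. partial i f x)"

definition curl :: "vfield \<Rightarrow> vfield" where
  "curl f x = (let D = (\<lambda>i k. partial i (\<lambda>y. vec_nth (f y) k) x)
     in vector [D 2 3 - D 3 2, D 3 1 - D 1 3, D 1 2 - D 2 1])"

primrec Ck :: "nat \<Rightarrow> (point \<Rightarrow> real) \<Rightarrow> bool" where
  "Ck 0 f \<longleftrightarrow> continuous_on UNIV f"
| "Ck (Suc k) f \<longleftrightarrow> (\<forall>x. f differentiable (at x)) \<and> (\<forall>i. Ck k (partial i f))"

definition test_fun :: "point set \<Rightarrow> (point \<Rightarrow> real) \<Rightarrow> bool" where
  "test_fun \<Omega> f \<longleftrightarrow> (\<forall>k. Ck k f) \<and>
     compact (closure {x. f x \<noteq> 0}) \<and> closure {x. f x \<noteq> 0} \<subseteq> \<Omega>"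

definition test_field :: "point set \<Rightarrow> vfield \<Rightarrow> bool" where
  "test_field \<Omega> f \<longleftrightarrow> (\<forall>i. test_fun \<Omega> (\<lambda>x. vec_nth (f x) i))"

definition L2 :: "point set \<Rightarrow> (point \<Rightarrow> 'b::euclidean_space) \<Rightarrow> bool" where
  "L2 \<Omega> u \<longleftrightarrow> set_borel_measurable lebesgue \<Omega> u \<and>
     set_integrable lebesgue \<Omega> (\<lambda>x. (norm (u x))\<^sup>2)"

definition has_weak_curl :: "point set \<Rightarrow> vfield \<Rightarrow> vfield \<Rightarrow> bool" where
  "has_weak_curl \<Omega> u w \<longleftrightarrow> L2 \<Omega> u \<and> L2 \<Omega> w \<and>
     (\<forall>\<psi>. test_field \<Omega> \<psi> \<longrightarrow>
        (LINT x:\<Omega>|lebesgue. inner (u x) (curl \<psi> x)) = (LINT x:\<Omega>|lebesgue. inner (w x) (\<psi> x)))"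

text \<open>The weak curl is determined up to a null set; only integrals of expressions in it are formed.\<close>

definition weak_curl :: "point set \<Rightarrow> vfield \<Rightarrow> vfield" where
  "weak_curl \<Omega> u = (SOME w. has_weak_curl \<Omega> u w)"

text \<open>\<open>H\<^sub>0(curl, \<Omega>)\<close> is the closure of the test fields with respect to the graph norm of the curl.\<close>

definition H0_curl :: "point set \<Rightarrow> vfield set" where
  "H0_curl \<Omega> = {u. \<exists>w \<psi>. has_weak_curl \<Omega> u w \<and> (\<forall>n::nat. test_field \<Omega> (\<psi> n)) \<and>
     (\<lambda>n. LINT x:\<Omega>|lebesgue. (norm (u x - \<psi> n x))\<^sup>2) \<longlonglongrightarrow> 0 \<and>
     (\<lambda>n. LINT x:\<Omega>|lebesgue. (norm (w x - curl (\<psi> n) x))\<^sup>2) \<longlonglongrightarrow> 0}"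

definition H1 :: "point set \<Rightarrow> (point \<Rightarrow> real) set" where
  "H1 \<Omega> = {u. L2 \<Omega> u \<and> (\<exists>g::vfield. L2 \<Omega> g \<and>
     (\<forall>\<phi> i. test_fun \<Omega> \<phi> \<longrightarrow>
        (LINT x:\<Omega>|lebesgue. u x * partial i \<phi> x) = - (LINT x:\<Omega>|lebesgue. vec_nth (g x) i * \<phi> x)))}"

definition weakly_div_free :: "point set \<Rightarrow> vfield \<Rightarrow> bool" where
  "weakly_div_free \<Omega> u \<longleftrightarrow>
     (\<forall>\<phi>. test_fun \<Omega> \<phi> \<longrightarrow> (LINT x:\<Omega>|lebesgue. inner (u x) (grad \<phi> x)) = 0)"

definition ess_support :: "point set \<Rightarrow> vfield \<Rightarrow> point set" where
  "ess_support \<Omega> u = {x. \<forall>r>0. \<not> (AE y in lebesgue. y \<in> \<Omega> \<inter> ball x r \<longrightarrow> u y = 0)}"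

section \<open>Lipschitz domains\<close>

text \<open>Near each boundary point the domain is the set of points lying above a Lipschitz graph in some
  direction \<open>e\<close>.\<close>

definition lipschitz_domain :: "point set \<Rightarrow> bool" where
  "lipschitz_domain \<Omega> \<longleftrightarrow> open \<Omega> \<and> connected \<Omega> \<and> \<Omega> \<noteq> {} \<and>
     (\<forall>p\<in>frontier \<Omega>. \<exists>U e L. \<exists>g :: point \<Rightarrow> real.
        open U \<and> p \<in> U \<and> norm e = 1 \<and> L-lipschitz_on {y. inner y e = 0} g \<and>
        (\<forall>x\<in>U. x \<in> \<Omega> \<longleftrightarrow> g (x - inner x e *\<^sub>R e) < inner x e))"

section \<open>Lowest order edge and face elements\<close>

definition vertices :: "point set \<Rightarrow> point set" where
  "vertices T = {v. v extreme_point_of T}"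

text \<open>Barycentric coordinate of \<open>x\<close> with respect to the vertex \<open>v\<close> of the tetrahedron \<open>T\<close>.\<close>

definition bary :: "point set \<Rightarrow> point \<Rightarrow> point \<Rightarrow> real" where
  "bary T v x = (THE c. \<exists>u. sum u (vertices T) = 1 \<and>
     (\<Sum>w\<in>vertices T. u w *\<^sub>R w) = x \<and> c = u v)"

text \<open>Oriented edges and faces of a mesh are given by their ordered vertices; each edge and face occurs
  here with all its vertex orderings.\<close>

definition mesh_edges :: "point set set \<Rightarrow> (point \<times> point) set" where
  "mesh_edges \<T> = {(a, b). a \<noteq> b \<and> (\<exists>T\<in>\<T>. {a, b} \<subseteq> vertices T)}"

definition mesh_faces :: "point set set \<Rightarrow> (point \<times> point \<times> point) set" where
  "mesh_faces \<T> = {(a, b, c). distinct [a, b, c] \<and> (\<exists>T\<in>\<T>. {a, b, c} \<subseteq> vertices T)}"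

fun edge_set :: "point \<times> point \<Rightarrow> point set" where
  "edge_set (a, b) = {a, b}"

fun face_set :: "point \<times> point \<times> point \<Rightarrow> point set" where
  "face_set (a, b, c) = {a, b, c}"

text \<open>The basis functions are given element by element. Interiors of distinct elements are disjoint, so
  the sums have at most one term; on the element boundaries, a null set, the value is \<open>0\<close>. With
  this normalisation the tangential component of an edge function has line integral \<open>1\<close> along its edge
  and the normal component of a face function has flux \<open>1\<close> through its face.\<close>

fun edge_fun :: "point set set \<Rightarrow> point \<times> point \<Rightarrow> vfield" where
  "edge_fun \<T> (a, b) x = (\<Sum>T\<in>{T\<in>\<T>. x \<in> interior T \<and> {a, b} \<subseteq> vertices T}.
     bary T a x *\<^sub>R grad (bary T b) x - bary T b x *\<^sub>R grad (bary T a) x)"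

fun face_fun :: "point set set \<Rightarrow> point \<times> point \<times> point \<Rightarrow> vfield" where
  "face_fun \<T> (a, b, c) x = (\<Sum>T\<in>{T\<in>\<T>. x \<in> interior T \<and> {a, b, c} \<subseteq> vertices T}.
     2 *\<^sub>R (bary T a x *\<^sub>R cross3 (grad (bary T b) x) (grad (bary T c) x)
         + bary T b x *\<^sub>R cross3 (grad (bary T c) x) (grad (bary T a) x)
         + bary T c x *\<^sub>R cross3 (grad (bary T a) x) (grad (bary T b) x)))"

fun incidence :: "point \<times> point \<times> point \<Rightarrow> point \<times> point \<Rightarrow> real" where
  "incidence (a, b, c) (p, q) =
     (if (p, q) \<in> {(a, b), (b, c), (c, a)} then 1
      else if (q, p) \<in> {(a, b), (b, c), (c, a)} then - 1 else 0)"

section \<open>The magneto-quasistatic problem and its discretisation\<close>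

text \<open>\<open>edges1\<close> and \<open>edges2\<close> list the oriented edges of the conducting and of the
  non-conducting part; \<open>coils\<close> is the number \<open>m\<close> of columns of the winding function.\<close>

record mqs =
  Omega :: "point set"
  OmegaC :: "point set"
  sigmaC :: real
  nuC :: "real \<Rightarrow> real"
  nuI :: real
  coils :: nat
  Res :: "real Matrix.mat"
  chi :: "nat \<Rightarrow> vfield"
  gamma :: "nat \<Rightarrow> vfield"
  mesh :: "point set set"
  edges1 :: "(point \<times> point) list"
  edges2 :: "(point \<times> point) list"
  faces :: "(point \<times> point \<times> point) list"

definition OmegaI :: "mqs \<Rightarrow> point set" where
  "OmegaI P = Omega P - closure (OmegaC P)"

definition spd_mat :: "nat \<Rightarrow> real Matrix.mat \<Rightarrow> bool" where
  "spd_mat n A \<longleftrightarrow> A \<in> carrier_mat n n \<and> transpose_mat A = A \<and>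
     (\<forall>v\<in>carrier_vec n. v \<noteq> 0\<^sub>v n \<longrightarrow> v \<bullet> (A *\<^sub>v v) > 0)"

definition mqs_domain :: "mqs \<Rightarrow> bool" where
  "mqs_domain P \<longleftrightarrow>
     lipschitz_domain (Omega P) \<and> bounded (Omega P) \<and> simply_connected (Omega P) \<and>
     open (OmegaC P) \<and> connected (OmegaC P) \<and> OmegaC P \<noteq> {} \<and> closure (OmegaC P) \<subseteq> Omega P \<and>
     finite (components (OmegaI P)) \<and>
     (\<exists>ext\<in>components (OmegaI P).
        components (frontier ext) = {closure ext \<inter> closure (OmegaC P), frontier (Omega P)} \<and>
        (\<forall>D\<in>components (OmegaI P) - {ext}. connected (frontier D)))"

definition mqs_data :: "mqs \<Rightarrow> bool" where
  "mqs_data P \<longleftrightarrow>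
     sigmaC P > 0 \<and> nuI P > 0 \<and>
     (\<forall>z\<ge>0. nuC P z \<ge> 0) \<and> set_borel_measurable borel {0..} (nuC P) \<and>
     (\<exists>mu>0. \<forall>z\<ge>0. \<forall>z'\<ge>0. (nuC P z * z - nuC P z' * z') * (z - z') \<ge> mu * (z - z')\<^sup>2) \<and>
     (\<exists>L>0. L-lipschitz_on {0..} (\<lambda>z. nuC P z * z)) \<and>
     spd_mat (coils P) (Res P) \<and>
     (\<forall>j<coils P. L2 (Omega P) (chi P j) \<and> weakly_div_free (Omega P) (chi P j)) \<and>
     (\<forall>i<coils P. \<forall>j<coils P. i \<noteq> j \<longrightarrow>
        ess_support (Omega P) (chi P i) \<inter> ess_support (Omega P) (chi P j) = {}) \<and>
     (\<forall>j<coils P. (\<forall>i. (\<lambda>x. vec_nth (gamma P j x) i) \<in> H1 (Omega P)) \<and>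
        has_weak_curl (Omega P) (gamma P j) (chi P j))"

text \<open>The mesh resolves the interface between the subdomains. The edges listed are those whose basis
  functions lie in \<open>H\<^sub>0(curl, \<Omega>)\<close>, each with one of its two orientations, and those contained in the
  closure of the conducting subdomain come first; the faces listed are all faces of the mesh, each
  with one vertex ordering.\<close>

definition mqs_mesh :: "mqs \<Rightarrow> bool" where
  "mqs_mesh P \<longleftrightarrow>
     triangulation (mesh P) \<and> (\<forall>T\<in>mesh P. 3 simplex T) \<and> \<Union>(mesh P) = closure (Omega P) \<and>
     (\<forall>T\<in>mesh P. interior T \<subseteq> OmegaC P \<or> interior T \<subseteq> OmegaI P) \<and>
     distinct (map edge_set (edges1 P @ edges2 P)) \<and>
     set (edges1 P @ edges2 P) \<subseteq> mesh_edges (mesh P) \<and>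
     edge_set ` set (edges1 P @ edges2 P) =
       edge_set ` {e \<in> mesh_edges (mesh P). edge_fun (mesh P) e \<in> H0_curl (Omega P)} \<and>
     (\<forall>(a, b)\<in>set (edges1 P). closed_segment a b \<subseteq> closure (OmegaC P)) \<and>
     (\<forall>(a, b)\<in>set (edges2 P). \<not> closed_segment a b \<subseteq> closure (OmegaC P)) \<and>
     distinct (map face_set (faces P)) \<and>
     set (faces P) \<subseteq> mesh_faces (mesh P) \<and>
     face_set ` set (faces P) = face_set ` mesh_faces (mesh P)"

definition sigma :: "mqs \<Rightarrow> point \<Rightarrow> real" where
  "sigma P x = sigmaC P * indicator (OmegaC P) x"

definition nu :: "mqs \<Rightarrow> point \<Rightarrow> real \<Rightarrow> real" where
  "nu P x z = nuC P z * indicator (OmegaC P) x + nuI P * indicator (OmegaI P) x"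

abbreviation n1 :: "mqs \<Rightarrow> nat" where "n1 P \<equiv> length (edges1 P)"
abbreviation n2 :: "mqs \<Rightarrow> nat" where "n2 P \<equiv> length (edges2 P)"
abbreviation ne :: "mqs \<Rightarrow> nat" where "ne P \<equiv> n1 P + n2 P"
abbreviation nf :: "mqs \<Rightarrow> nat" where "nf P \<equiv> length (faces P)"

definition phi_e :: "mqs \<Rightarrow> nat \<Rightarrow> vfield" where
  "phi_e P j = edge_fun (mesh P) ((edges1 P @ edges2 P) ! j)"

definition phi_f :: "mqs \<Rightarrow> nat \<Rightarrow> vfield" where
  "phi_f P k = face_fun (mesh P) (faces P ! k)"

abbreviation curl_e :: "mqs \<Rightarrow> nat \<Rightarrow> vfield" where
  "curl_e P j \<equiv> weak_curl (Omega P) (phi_e P j)"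

definition C_d :: "mqs \<Rightarrow> real Matrix.mat" where
  "C_d P = Matrix.mat (nf P) (ne P)
     (\<lambda>(k, j). incidence (faces P ! k) ((edges1 P @ edges2 P) ! j))"

definition M_sigma :: "mqs \<Rightarrow> real Matrix.mat" where
  "M_sigma P = Matrix.mat (ne P) (ne P)
     (\<lambda>(k, l). LINT x:Omega P|lebesgue. sigma P x * inner (phi_e P l x) (phi_e P k x))"

definition K :: "mqs \<Rightarrow> real Matrix.vec \<Rightarrow> real Matrix.mat" where
  "K P a = Matrix.mat (ne P) (ne P)
     (\<lambda>(k, l). LINT x:Omega P|lebesgue.
        nu P x (norm (weak_curl (Omega P) (\<lambda>y. \<Sum>j<ne P. vec_index a j *\<^sub>R phi_e P j y) x)) *
        inner (curl_e P l x) (curl_e P k x))"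

definition X :: "mqs \<Rightarrow> real Matrix.mat" where
  "X P = Matrix.mat (ne P) (coils P)
     (\<lambda>(k, j). LINT x:Omega P|lebesgue. inner (chi P j x) (phi_e P k x))"

definition M_nu :: "mqs \<Rightarrow> real Matrix.vec \<Rightarrow> real Matrix.mat" where
  "M_nu P b = Matrix.mat (nf P) (nf P)
     (\<lambda>(k, l). LINT x:Omega P|lebesgue.
        nu P x (norm (\<Sum>j<nf P. vec_index b j *\<^sub>R phi_f P j x)) * inner (phi_f P l x) (phi_f P k x))"

definition Upsilon :: "mqs \<Rightarrow> real Matrix.mat" where
  "Upsilon P = Matrix.mat (nf P) (coils P)
     (\<lambda>(k, j). LINT x:Omega P|lebesgue. inner (gamma P j x) (phi_f P k x))"

definition M11 :: "mqs \<Rightarrow> real Matrix.mat" where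
  "M11 P = Matrix.mat (n1 P) (n1 P) (\<lambda>(k, l). M_sigma P $$ (k, l))"

definition C1 :: "mqs \<Rightarrow> real Matrix.mat" where
  "C1 P = Matrix.mat (nf P) (n1 P) (\<lambda>(k, j). C_d P $$ (k, j))"

definition C2 :: "mqs \<Rightarrow> real Matrix.mat" where
  "C2 P = Matrix.mat (nf P) (n2 P) (\<lambda>(k, j). C_d P $$ (k, n1 P + j))"

definition X1 :: "mqs \<Rightarrow> real Matrix.mat" where
  "X1 P = Matrix.mat (n1 P) (coils P) (\<lambda>(k, j). X P $$ (k, j))"

definition X2 :: "mqs \<Rightarrow> real Matrix.mat" where
  "X2 P = Matrix.mat (n2 P) (coils P) (\<lambda>(k, j). X P $$ (n1 P + k, j))"

abbreviation k2 :: "mqs \<Rightarrow> nat" where "k2 P \<equiv> kernel_dim (C2 P)"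
abbreviation nr :: "mqs \<Rightarrow> nat" where "nr P \<equiv> n1 P + (n2 P - k2 P)"

section \<open>The reduced matrices\<close>

text \<open>\<open>Y\<close> stands for the matrix whose columns form a basis of the image of the transpose of \<open>C2\<close>.\<close>

definition basis_mat :: "nat \<Rightarrow> real Matrix.mat \<Rightarrow> real Matrix.vec set \<Rightarrow> bool" where
  "basis_mat n Y S \<longleftrightarrow> Y \<in> carrier_mat n (dim_col Y) \<and> distinct (cols Y) \<and>
     module.lin_indpt class_ring (module_vec TYPE(real) n) (set (cols Y)) \<and>
     module.span class_ring (module_vec TYPE(real) n) (set (cols Y)) = S"

definition F_sigma :: "mqs \<Rightarrow> real Matrix.mat \<Rightarrow> real Matrix.mat" where
  "F_sigma P Y = four_block_mat (1\<^sub>m (n1 P)) (X1 P)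
     (0\<^sub>m (n2 P - k2 P) (n1 P)) (transpose_mat Y * X2 P)"

definition M_sigma_R :: "mqs \<Rightarrow> real Matrix.mat" where
  "M_sigma_R P = four_block_mat (M11 P) (0\<^sub>m (n1 P) (coils P))
     (0\<^sub>m (coils P) (n1 P)) (the (mat_inverse (Res P)))"

definition F_nu :: "mqs \<Rightarrow> real Matrix.mat \<Rightarrow> real Matrix.mat" where
  "F_nu P Y = transpose_mat (C1 P) @\<^sub>r (transpose_mat Y * transpose_mat (C2 P))"

definition E_r :: "mqs \<Rightarrow> real Matrix.mat \<Rightarrow> real Matrix.mat" where
  "E_r P Y = F_sigma P Y * M_sigma_R P * transpose_mat (F_sigma P Y)"

definition A_r :: "mqs \<Rightarrow> real Matrix.mat \<Rightarrow> real Matrix.vec \<Rightarrow> real Matrix.mat" where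
  "A_r P Y x = - (F_nu P Y * M_nu P (transpose_mat (F_nu P Y) *\<^sub>v x) * transpose_mat (F_nu P Y))"

end

theory Submission
  imports Defs
begin

text \<open>The matrices \<open>E = E_r\<close> and \<open>S x = - A_r x\<close> are symmetric positive semidefinite, because they have the
  form \<open>F M F\<^sup>T\<close> with \<open>M\<close> definite; in particular the kernel of each is the kernel of \<open>F\<^sup>T\<close>. This
  gives three facts.

  \<^item> The kernel of \<open>S x\<close> is that of \<open>F_nu\<^sup>T\<close>, hence independent of \<open>x\<close>.

  \<^item> The kernel of \<open>E\<close> is that of \<open>F_sigma\<^sup>T\<close>, hence consists of vectors whose conducting part vanishes. As the
    nonlinearity sits in the conducting block alone, \<open>S x v\<close> is independent of \<open>x\<close> for \<open>v\<close> in
    this kernel.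

  \<^item> The two kernels meet only in zero. A common kernel vector is \<open>(0, w)\<close> with \<open>C2 (Y w) = 0\<close>. Since \<open>Y w\<close>
    lies in the range of \<open>C2\<^sup>T\<close>, which is orthogonal to the kernel of \<open>C2\<close>, it vanishes, and so does
    \<open>w\<close>, as the columns of \<open>Y\<close> are independent.

  From here on the argument is linear algebra of two quadratic forms, carried out in
  \<open>simultaneous_normal_form\<close>. Write \<open>V\<^sub>\<infinity>\<close> and \<open>V\<^sub>0\<close> for the kernels of \<open>E\<close> and of \<open>S x\<close>. The
  form \<open>S x\<close> is definite on \<open>V\<^sub>\<infinity>\<close>, so \<open>V\<^sub>\<infinity>\<close> has an \<open>S x\<close>-orthogonal complement, and this complement is
  the same for all \<open>x\<close> because \<open>S x\<close> is constant on \<open>V\<^sub>\<infinity>\<close>. The complement contains \<open>V\<^sub>0\<close>, and \<open>E\<close> is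
  definite on it; let \<open>V\<^sub>s\<close> be the \<open>E\<close>-orthogonal complement of \<open>V\<^sub>0\<close> in it. On \<open>V\<^sub>s\<close> both forms are definite, the three
  subspaces are orthogonal for both forms, and the columns of \<open>W\<close> are a basis of
  \<open>V\<^sub>s\<close>, an \<open>E\<close>-orthonormal basis of \<open>V\<^sub>0\<close> and an \<open>S x\<close>-orthonormal basis of \<open>V\<^sub>\<infinity>\<close>.

  In matrix form, each orthogonal complement is one block Gaussian elimination, \<open>block_elimination\<close>,
  whose transformation depends only on the constant blocks. Adapted bases come from Sylvester's
  normal form \<open>psd_normal_form\<close>.\<close>

(* The dot stands for the scalar product of vectors with explicit carriers. *)
unbundle no inner_syntax

section \<open>Congruence of semidefinite forms\<close>

definition psd_mat :: "nat \<Rightarrow> real Matrix.mat \<Rightarrow> bool" where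
  "psd_mat n A \<longleftrightarrow> A \<in> carrier_mat n n \<and> transpose_mat A = A \<and>
     (\<forall>v\<in>carrier_vec n. v \<bullet> (A *\<^sub>v v) \<ge> 0)"

definition cong_mat :: "real Matrix.mat \<Rightarrow> real Matrix.mat \<Rightarrow> real Matrix.mat" where
  "cong_mat W A = transpose_mat W * A * W"

lemma cong_mat_carrier [intro]:
  assumes "W \<in> carrier_mat n m" "A \<in> carrier_mat n n"
  shows "cong_mat W A \<in> carrier_mat m m"
  using assms unfolding cong_mat_def by auto

lemma cong_mat_comp:
  assumes W: "W \<in> carrier_mat n m" and V: "V \<in> carrier_mat m l" and A: "A \<in> carrier_mat n n"
  shows "cong_mat V (cong_mat W A) = cong_mat (W * V) A"
proof -
  have WT: "transpose_mat W \<in> carrier_mat m n" and VT: "transpose_mat V \<in> carrier_mat l m"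
    using W V by auto
  have "transpose_mat V * (transpose_mat W * A * W) * V
      = transpose_mat V * (transpose_mat W * A * W * V)"
    using W V A by (intro assoc_mult_mat[of _ l m _ m _ l]) auto
  also have "transpose_mat W * A * W * V = transpose_mat W * (A * (W * V))"
    using W V A by (simp add: assoc_mult_mat[of _ m n _ n _ l] assoc_mult_mat[of _ m n _ m _ l]
      assoc_mult_mat[of _ m n _ n _ m] assoc_mult_mat[of _ n n _ m _ l])
  also have "transpose_mat V * (transpose_mat W * (A * (W * V)))
      = transpose_mat V * transpose_mat W * (A * (W * V))"
    using W V A by (intro assoc_mult_mat[of _ l m _ n _ l, symmetric]) auto
  also have "\<dots> = transpose_mat V * transpose_mat W * A * (W * V)"
    using W V A by (intro assoc_mult_mat[of _ l n _ n _ l, symmetric]) auto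
  finally show ?thesis
    unfolding cong_mat_def transpose_mult[OF W V] .
qed

lemma cong_mat_mult_vec:
  assumes W: "W \<in> carrier_mat n m" and A: "A \<in> carrier_mat n n" and v: "v \<in> carrier_vec m"
  shows "cong_mat W A *\<^sub>v v = transpose_mat W *\<^sub>v (A *\<^sub>v (W *\<^sub>v v))"
proof -
  have "transpose_mat W * A * W *\<^sub>v v = transpose_mat W * A *\<^sub>v (W *\<^sub>v v)"
    using W A v by (intro assoc_mult_mat_vec[of _ m n _ m]) auto
  also have "\<dots> = transpose_mat W *\<^sub>v (A *\<^sub>v (W *\<^sub>v v))"
    using W A v by (intro assoc_mult_mat_vec[of _ m n _ n]) auto
  finally show ?thesis unfolding cong_mat_def .
qed

lemma cong_mat_form:
  assumes W: "W \<in> carrier_mat n m" and A: "A \<in> carrier_mat n n" and v: "v \<in> carrier_vec m"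
  shows "v \<bullet> (cong_mat W A *\<^sub>v v) = (W *\<^sub>v v) \<bullet> (A *\<^sub>v (W *\<^sub>v v))"
proof -
  have c: "A *\<^sub>v (W *\<^sub>v v) \<in> carrier_vec n" "W *\<^sub>v v \<in> carrier_vec n"
    using W A v by auto
  have "v \<bullet> (transpose_mat W *\<^sub>v (A *\<^sub>v (W *\<^sub>v v)))
      = (transpose_mat W *\<^sub>v (A *\<^sub>v (W *\<^sub>v v))) \<bullet> v"
    using W v c by (intro comm_scalar_prod[of _ m]) auto
  also have "\<dots> = (A *\<^sub>v (W *\<^sub>v v)) \<bullet> (W *\<^sub>v v)"
    by (rule transpose_vec_mult_scalar[OF W v c(1)])
  also have "\<dots> = (W *\<^sub>v v) \<bullet> (A *\<^sub>v (W *\<^sub>v v))"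
    by (rule comm_scalar_prod[OF c])
  finally show ?thesis unfolding cong_mat_mult_vec[OF W A v] .
qed

lemma cong_mat_symmetric:
  assumes W: "W \<in> carrier_mat n m" and A: "A \<in> carrier_mat n n" and s: "transpose_mat A = A"
  shows "transpose_mat (cong_mat W A) = cong_mat W A"
proof -
  have "transpose_mat (transpose_mat W * A * W)
      = transpose_mat W * transpose_mat (transpose_mat W * A)"
    using W A by (intro transpose_mult[of _ m n _ m]) auto
  also have "transpose_mat (transpose_mat W * A) = A * W"
    using W A s by (subst transpose_mult[of _ m n _ n]) auto
  finally show ?thesis
    using W A unfolding cong_mat_def by (simp add: assoc_mult_mat[of _ m n _ n _ m])
qed

lemma psd_mat_cong:
  assumes W: "W \<in> carrier_mat n m" and A: "psd_mat n A"
  shows "psd_mat m (cong_mat W A)"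
  using assms cong_mat_symmetric[OF W] cong_mat_form[OF W]
  unfolding psd_mat_def by (auto intro!: mult_mat_vec_carrier)

lemma spd_mat_cong:
  assumes W: "W \<in> carrier_mat n m" and A: "spd_mat n A"
    and inj: "\<And>v. v \<in> carrier_vec m \<Longrightarrow> W *\<^sub>v v = 0\<^sub>v n \<Longrightarrow> v = 0\<^sub>v m"
  shows "spd_mat m (cong_mat W A)"
proof -
  have c: "A \<in> carrier_mat n n" "transpose_mat A = A" using A unfolding spd_mat_def by auto
  show ?thesis unfolding spd_mat_def
  proof (intro conjI ballI impI)
    show "cong_mat W A \<in> carrier_mat m m" using W c by auto
    show "transpose_mat (cong_mat W A) = cong_mat W A" by (rule cong_mat_symmetric[OF W c])
    fix v :: "real Matrix.vec" assume v: "v \<in> carrier_vec m" "v \<noteq> 0\<^sub>v m"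
    then have "W *\<^sub>v v \<noteq> 0\<^sub>v n" "W *\<^sub>v v \<in> carrier_vec n" using inj W by auto
    then show "0 < v \<bullet> (cong_mat W A *\<^sub>v v)"
      using A unfolding cong_mat_form[OF W c(1) v(1)] spd_mat_def by auto
  qed
qed

lemma spd_imp_psd:
  assumes "spd_mat n A" shows "psd_mat n A"
  unfolding psd_mat_def
proof (intro conjI ballI)
  show c: "A \<in> carrier_mat n n" "transpose_mat A = A" using assms unfolding spd_mat_def by auto
  fix v :: "real Matrix.vec" assume v: "v \<in> carrier_vec n"
  show "v \<bullet> (A *\<^sub>v v) \<ge> 0"
  proof (cases "v = 0\<^sub>v n")
    case True
    then show ?thesis using mult_mat_vec_carrier[OF c(1) v] by simp
  next
    case False
    then show ?thesis using assms v unfolding spd_mat_def by force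
  qed
qed

section \<open>Nonsingular matrices\<close>

text \<open>Nonvanishing of the determinant passes to products and to block triangular matrices by the
  product formulas for determinants, so no inverse ever has to be exhibited.\<close>

definition nonsing :: "nat \<Rightarrow> real Matrix.mat \<Rightarrow> bool" where
  "nonsing n W \<longleftrightarrow> W \<in> carrier_mat n n \<and> Determinant.det W \<noteq> 0"

lemma nonsing_carrier: "nonsing n W \<Longrightarrow> W \<in> carrier_mat n n"
  unfolding nonsing_def by simp

lemma nonsing_inj:
  assumes "nonsing n W" "v \<in> carrier_vec n" "W *\<^sub>v v = 0\<^sub>v n"
  shows "v = 0\<^sub>v n"
  using assms det_0_iff_vec_prod_zero_field[of W n] unfolding nonsing_def by auto

lemma nonsing_transpose: "nonsing n W \<Longrightarrow> nonsing n (transpose_mat W)"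
  unfolding nonsing_def using det_transpose[of W n] by auto

lemma nonsing_mult: "nonsing n V \<Longrightarrow> nonsing n W \<Longrightarrow> nonsing n (V * W)"
  unfolding nonsing_def using det_mult[of V n W] by auto

lemma nonsing_one: "nonsing n (1\<^sub>m n)"
  unfolding nonsing_def by auto

lemma nonsing_imp_invertible:
  assumes "nonsing n W" shows "invertible_mat W"
proof -
  have W: "W \<in> carrier_mat n n" using assms unfolding nonsing_def by auto
  obtain B where B: "B \<in> carrier_mat n n" "B * W = 1\<^sub>m n" "W * B = 1\<^sub>m n"
    using det_non_zero_imp_unit[OF W, of "()"] assms
    unfolding nonsing_def Units_def ring_mat_def by auto
  then show ?thesis using W unfolding invertible_mat_def inverts_mat_def by auto
qed

lemma nonsing_lower_triangular:
  assumes "nonsing n A" "nonsing m D" "C \<in> carrier_mat m n"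
  shows "nonsing (n + m) (four_block_mat A (0\<^sub>m n m) C D)"
  using assms det_four_block_mat_upper_right_zero[of A n "0\<^sub>m n m" m C D]
  unfolding nonsing_def by auto

section \<open>Block diagonal matrices\<close>

definition dsum :: "real Matrix.mat \<Rightarrow> real Matrix.mat \<Rightarrow> real Matrix.mat" where
  "dsum A B = four_block_mat A (0\<^sub>m (dim_row A) (dim_col B)) (0\<^sub>m (dim_row B) (dim_col A)) B"

lemma dsum_eq:
  assumes "A \<in> carrier_mat n n" "B \<in> carrier_mat m m"
  shows "dsum A B = four_block_mat A (0\<^sub>m n m) (0\<^sub>m m n) B"
  using assms unfolding dsum_def by auto

lemma dsum_carrier [intro]:
  "A \<in> carrier_mat n n \<Longrightarrow> B \<in> carrier_mat m m \<Longrightarrow> dsum A B \<in> carrier_mat (n + m) (n + m)"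
  unfolding dsum_def by auto

lemma dsum_assoc: "dsum (dsum A B) C = dsum A (dsum B C)"
  unfolding dsum_def by (rule assoc_four_block_mat[symmetric])

lemma diag_block_mat_three: "diag_block_mat [A, B, C] = dsum (dsum A B) C"
proof -
  have "diag_block_mat [A, B, C] = dsum A (diag_block_mat [B, C])"
    unfolding dsum_def diag_block_mat.simps(2)[of A] Let_def ..
  also have "diag_block_mat [B, C] = dsum B (diag_block_mat [C])"
    unfolding dsum_def diag_block_mat.simps(2)[of B] Let_def ..
  finally show ?thesis unfolding diag_block_mat_singleton dsum_assoc .
qed

lemma dsum_one: "dsum (1\<^sub>m n) (1\<^sub>m m) = 1\<^sub>m (n + m)"
  unfolding dsum_def by simp

lemma dsum_zero: "dsum (0\<^sub>m n n) (0\<^sub>m m m) = 0\<^sub>m (n + m) (n + m)"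
  unfolding dsum_def by simp

lemma dsum_mult_vec:
  assumes "A \<in> carrier_mat n n" "B \<in> carrier_mat m m" "v \<in> carrier_vec n" "w \<in> carrier_vec m"
  shows "dsum A B *\<^sub>v (v @\<^sub>v w) = (A *\<^sub>v v) @\<^sub>v (B *\<^sub>v w)"
  unfolding dsum_eq[OF assms(1,2)] by (rule mult_mat_vec_split[OF assms])

lemma nonsing_dsum:
  assumes "nonsing n A" "nonsing m B" shows "nonsing (n + m) (dsum A B)"
  unfolding dsum_eq[OF nonsing_carrier[OF assms(1)] nonsing_carrier[OF assms(2)]]
  using assms by (intro nonsing_lower_triangular) auto

lemma cong_mat_dsum:
  assumes c: "U \<in> carrier_mat n n" "V \<in> carrier_mat m m" "A \<in> carrier_mat n n" "B \<in> carrier_mat m m"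
  shows "cong_mat (dsum U V) (dsum A B) = dsum (cong_mat U A) (cong_mat V B)"
proof -
  let ?UT = "transpose_mat U" and ?VT = "transpose_mat V"
  have d: "dsum P Q * dsum R S = dsum (P * R) (Q * S)"
    if "P \<in> carrier_mat n n" "Q \<in> carrier_mat m m" "R \<in> carrier_mat n n" "S \<in> carrier_mat m m"
    for P Q R S :: "real Matrix.mat"
    using that
    by (simp add: dsum_eq[of _ n _ m] mult_four_block_mat[of _ n n _ m _ m _ _ n _ m])
  have t: "transpose_mat (dsum U V) = dsum ?UT ?VT"
    using c by (simp add: dsum_eq[of _ n _ m] transpose_four_block_mat[of _ n n _ m _ m])
  show ?thesis
    using c unfolding cong_mat_def t by (simp add: d)
qed

text \<open>A permutation matrix exchanges the two blocks. This is what brings a newly found positive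
  diagonal entry to the front in the normal form below.\<close>

lemma dsum_swap:
  assumes c: "A \<in> carrier_mat n n" "B \<in> carrier_mat m m"
  obtains Q where "nonsing (n + m) Q" "cong_mat Q (dsum A B) = dsum B A"
proof
  let ?Q = "four_block_mat (0\<^sub>m n m) (1\<^sub>m n) (1\<^sub>m m) (0\<^sub>m m n) :: real Matrix.mat"
  have t: "transpose_mat ?Q = four_block_mat (0\<^sub>m m n) (1\<^sub>m m) (1\<^sub>m n) (0\<^sub>m n m)"
    by (subst transpose_four_block_mat[of _ n m _ n _ m]) auto
  have dim: "dim_row ?Q = n + m" "dim_col ?Q = n + m" by auto
  then have Qc: "?Q \<in> carrier_mat (n + m) (n + m)" by (rule carrier_matI)
  have "transpose_mat ?Q * ?Q = four_block_mat (1\<^sub>m m) (0\<^sub>m m n) (0\<^sub>m n m) (1\<^sub>m n)"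
    unfolding t by (subst mult_four_block_mat[of _ m n _ m _ n _ _ m _ n]) auto
  then have "transpose_mat ?Q * ?Q = 1\<^sub>m (n + m)"
    unfolding four_block_one_mat by (simp only: add.commute)
  moreover have "Determinant.det (transpose_mat ?Q * ?Q)
      = Determinant.det (transpose_mat ?Q) * Determinant.det ?Q"
    by (rule det_mult[OF _ Qc]) (simp only: transpose_carrier_mat Qc)
  ultimately have "Determinant.det ?Q \<noteq> 0" by (metis det_one mult_zero_right zero_neq_one)
  then show "nonsing (n + m) ?Q" using Qc unfolding nonsing_def by blast
  have "dsum A B * ?Q = four_block_mat (0\<^sub>m n m) A B (0\<^sub>m m n)"
    unfolding dsum_eq[OF c] using c
    by (subst mult_four_block_mat[of _ n n _ m _ m _ _ m _ n]) auto
  then have "transpose_mat ?Q * (dsum A B * ?Q)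
      = four_block_mat (0\<^sub>m m n) (1\<^sub>m m) (1\<^sub>m n) (0\<^sub>m n m) * four_block_mat (0\<^sub>m n m) A B (0\<^sub>m m n)"
    unfolding t by simp
  also have "\<dots> = dsum B A"
    unfolding dsum_eq[OF c(2,1)] using c
    by (subst mult_four_block_mat[of _ m n _ m _ n _ _ m _ n]) auto
  finally show "cong_mat ?Q (dsum A B) = dsum B A"
    using Qc dsum_carrier[OF c] unfolding cong_mat_def
    by (subst assoc_mult_mat[of _ "n + m" "n + m" _ "n + m" _ "n + m"]) (simp_all only: transpose_carrier_mat)
qed

section \<open>Vectors and blocks\<close>

lemma mat_eqI_mult_vec:
  assumes A: "A \<in> carrier_mat n m" and B: "B \<in> carrier_mat n m"
    and eq: "\<And>w. w \<in> carrier_vec m \<Longrightarrow> A *\<^sub>v w = B *\<^sub>v w"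
  shows "A = (B :: real Matrix.mat)"
proof (rule eq_matI)
  fix i j assume ij: "i < dim_row B" "j < dim_col B"
  then show "A $$ (i, j) = B $$ (i, j)"
    using arg_cong[OF eq[of "unit_vec m j"], of "\<lambda>v. v $ i"] A B by simp
qed (use A B in auto)

lemma zero_vec_append: "0\<^sub>v n @\<^sub>v 0\<^sub>v m = 0\<^sub>v (n + m)"
  by (intro eq_vecI) auto

lemma append_vec_zeroD:
  assumes "v \<in> carrier_vec n" "v @\<^sub>v w = 0\<^sub>v (n + m)"
  shows "v = 0\<^sub>v n" "w = 0\<^sub>v m"
  using assms append_vec_eq[of v n "0\<^sub>v n" w "0\<^sub>v m"] unfolding zero_vec_append[symmetric] by auto

lemma mult_zero_vec: "A \<in> carrier_mat n m \<Longrightarrow> A *\<^sub>v 0\<^sub>v m = (0\<^sub>v n :: real Matrix.vec)"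
  by (intro eq_vecI) auto

lemma four_block_mult_lower:
  assumes "A \<in> carrier_mat n n" "B \<in> carrier_mat n m" "C \<in> carrier_mat m n" "D \<in> carrier_mat m m"
    "w \<in> carrier_vec m"
  shows "four_block_mat A B C D *\<^sub>v (0\<^sub>v n @\<^sub>v w) = (B *\<^sub>v w) @\<^sub>v (D *\<^sub>v w :: real Matrix.vec)"
  using assms by (subst four_block_mat_mult_vec[of _ n n _ m _ m]) (auto simp: mult_zero_vec[of A n n] mult_zero_vec[of C m n])

section \<open>Semidefinite matrices\<close>

text \<open>The form is nonnegative at \<open>v + t A v\<close> for every \<open>t\<close>. As a polynomial in \<open>t\<close> it has no constant term
  when \<open>v\<close> is isotropic, and its linear coefficient is twice the square of \<open>A v\<close>; a small
  negative \<open>t\<close> would make it negative unless \<open>A v = 0\<close>.\<close>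

lemma psd_mat_kernel:
  assumes A: "psd_mat n A" and v: "v \<in> carrier_vec n" and z: "v \<bullet> (A *\<^sub>v v) = 0"
  shows "A *\<^sub>v v = 0\<^sub>v n"
proof (rule ccontr)
  assume nz: "A *\<^sub>v v \<noteq> 0\<^sub>v n"
  have c: "A \<in> carrier_mat n n" and s: "transpose_mat A = A" using A unfolding psd_mat_def by auto
  define w where "w = A *\<^sub>v v"
  have w: "w \<in> carrier_vec n" and Aw: "A *\<^sub>v w \<in> carrier_vec n" using c v unfolding w_def by auto
  have vw: "v \<bullet> w = 0" using z unfolding w_def .
  define p where "p = w \<bullet> w"
  define q where "q = w \<bullet> (A *\<^sub>v w)"
  have "p \<ge> 0" unfolding p_def scalar_prod_def by (intro sum_nonneg) auto
  moreover have "p \<noteq> 0" using conjugate_square_eq_0_vec[OF w] nz unfolding p_def w_def by auto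
  ultimately have p: "p > 0" by simp
  have q: "q \<ge> 0" using A w unfolding psd_mat_def q_def by auto
  (* Near the minimiser - p / q of the parabola; the summand 1 covers the case q = 0. *)
  define t where "t = - p / (q + 1)"
  have pt: "p = - t * (q + 1)" and t: "t < 0" using p q unfolding t_def by (auto simp: field_simps)
  have vAw: "v \<bullet> (A *\<^sub>v w) = p"
    using transpose_vec_mult_scalar[OF c w v] s unfolding p_def w_def by simp
  have "A *\<^sub>v (v + t \<cdot>\<^sub>v w) = w + t \<cdot>\<^sub>v (A *\<^sub>v w)"
    using c v w by (simp add: mult_add_distrib_mat_vec[of _ n n] mult_mat_vec[of _ n n] w_def)
  then have "(v + t \<cdot>\<^sub>v w) \<bullet> (A *\<^sub>v (v + t \<cdot>\<^sub>v w)) = v \<bullet> w + t * (v \<bullet> (A *\<^sub>v w)) + t * (p + t * q)"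
    using v w Aw by (simp add: add_scalar_prod_distrib[of _ n] scalar_prod_add_distrib[of _ n] p_def q_def algebra_simps)
  also have "\<dots> = 2 * t * p + t\<^sup>2 * q"
    using vw unfolding vAw by (simp add: algebra_simps power2_eq_square)
  also have "\<dots> = - (t\<^sup>2 * (q + 2))"
    unfolding pt by (simp add: algebra_simps power2_eq_square)
  also have "\<dots> < 0" using t q by simp
  finally have "(v + t \<cdot>\<^sub>v w) \<bullet> (A *\<^sub>v (v + t \<cdot>\<^sub>v w)) < 0" .
  moreover have "v + t \<cdot>\<^sub>v w \<in> carrier_vec n" using v w by auto
  ultimately show False using A unfolding psd_mat_def by force
qed

lemma psd_mat_spdI:
  assumes "psd_mat n A" "\<And>v. v \<in> carrier_vec n \<Longrightarrow> A *\<^sub>v v = 0\<^sub>v n \<Longrightarrow> v = 0\<^sub>v n"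
  shows "spd_mat n A"
  unfolding spd_mat_def
proof (intro conjI ballI impI)
  show "A \<in> carrier_mat n n" "transpose_mat A = A" using assms(1) unfolding psd_mat_def by auto
  fix v :: "real Matrix.vec" assume v: "v \<in> carrier_vec n" "v \<noteq> 0\<^sub>v n"
  then have "v \<bullet> (A *\<^sub>v v) \<noteq> 0" using assms(2) psd_mat_kernel[OF assms(1)] by blast
  moreover have "v \<bullet> (A *\<^sub>v v) \<ge> 0" using assms(1) v unfolding psd_mat_def by blast
  ultimately show "v \<bullet> (A *\<^sub>v v) > 0" by simp
qed

lemma spd_mat_kernel:
  assumes "spd_mat n A" "v \<in> carrier_vec n" "A *\<^sub>v v = 0\<^sub>v n"
  shows "v = 0\<^sub>v n"
proof (rule ccontr)
  assume "v \<noteq> 0\<^sub>v n"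
  then have "v \<bullet> (A *\<^sub>v v) > 0" using assms unfolding spd_mat_def by blast
  then show False using assms by simp
qed

lemma spd_mat_nonsing: "spd_mat n A \<Longrightarrow> nonsing n A"
  using spd_mat_kernel[of n A] det_0_iff_vec_prod_zero_field[of A n]
  unfolding nonsing_def spd_mat_def by auto

lemma spd_mat_one: "spd_mat n (1\<^sub>m n)"
proof (rule psd_mat_spdI)
  show "psd_mat n (1\<^sub>m n)" unfolding psd_mat_def
    by (auto simp: scalar_prod_def intro!: sum_nonneg)
qed auto

section \<open>Eliminating a definite diagonal block\<close>

text \<open>Block Gaussian elimination. With \<open>T\<^sup>T D T = I\<close> one has \<open>D\<inverse> = T T\<^sup>T\<close>, and the congruence by the lower
  triangular matrix with blocks \<open>I\<close>, \<open>0\<close>, \<open>- D\<inverse> B\<^sup>T\<close>, \<open>T\<close> clears the off-diagonal blocks, leaving the Schur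
  complement \<open>A - H\<close> with \<open>H = B D\<inverse> B\<^sup>T\<close>. Two features matter later. First, \<open>V\<close> and \<open>H\<close> depend on
  \<open>B\<close> and \<open>D\<close> only, so the same \<open>V\<close> serves a whole family of matrices that differ in the block \<open>A\<close>.
  Second, \<open>V\<close> leaves the forms that live on the first block unchanged, so that a second form can be
  reduced without disturbing a first one.\<close>

lemma block_elimination:
  assumes B: "B \<in> carrier_mat r k" and D: "D \<in> carrier_mat k k" "transpose_mat D = D"
    and T: "nonsing k T" "cong_mat T D = 1\<^sub>m k"
  obtains V H where "nonsing (r + k) V" "H \<in> carrier_mat r r"
    "\<And>A. A \<in> carrier_mat r r \<Longrightarrow>
       cong_mat V (four_block_mat A B (transpose_mat B) D) = dsum (A - H) (1\<^sub>m k)"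
    "\<And>Z. Z \<in> carrier_mat r r \<Longrightarrow> cong_mat V (dsum Z (0\<^sub>m k k)) = dsum Z (0\<^sub>m k k)"
proof
  let ?t = "transpose_mat :: real Matrix.mat \<Rightarrow> _"
  have Tc: "T \<in> carrier_mat k k" and TTc: "?t T \<in> carrier_mat k k"
    using nonsing_carrier[OF T(1)] by auto
  have BT: "?t B \<in> carrier_mat k r" using B by auto
  define G where "G = T * ?t T"
  have G: "G \<in> carrier_mat k k" using Tc unfolding G_def by auto
  have GT: "?t G = G" unfolding G_def using Tc by (subst transpose_mult[of _ k k _ k]) auto
  have TDT: "?t T * (D * T) = 1\<^sub>m k"
    using T(2) Tc D unfolding cong_mat_def by (subst assoc_mult_mat[of _ k k _ k _ k, symmetric]) auto
  (* T T^T is a left inverse of D by construction; for square matrices it is also a right inverse. *)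
  have "(D * T) * ?t T = 1\<^sub>m k"
    by (rule mat_mult_left_right_inverse[OF _ _ TDT]) (use Tc D in auto)
  then have DG: "D * G = 1\<^sub>m k"
    unfolding G_def using Tc D by (subst assoc_mult_mat[of _ k k _ k _ k, symmetric]) auto
  define L where "L = - (G * ?t B)"
  have L: "L \<in> carrier_mat k r" using G BT unfolding L_def by auto
  have LT: "?t L = - (B * G)"
    unfolding L_def transpose_uminus using G BT GT by (subst transpose_mult[of _ k k _ r]) auto
  have LTc: "?t L \<in> carrier_mat r k" using L by auto
  have DL: "D * L = - ?t B"
  proof -
    have "D * L = - (D * (G * ?t B))" unfolding L_def using D G BT by simp
    also have "D * (G * ?t B) = D * G * ?t B"
      using D G BT by (intro assoc_mult_mat[of _ k k _ k _ r, symmetric]) auto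
    finally show ?thesis using BT unfolding DG by simp
  qed
  define H where "H = - (B * L)"
  show Hc: "H \<in> carrier_mat r r" using B L unfolding H_def by auto
  let ?V = "four_block_mat (1\<^sub>m r) (0\<^sub>m r k) L T"
  show nsV: "nonsing (r + k) ?V" by (rule nonsing_lower_triangular[OF nonsing_one T(1) L])
  note Vc = nonsing_carrier[OF this]
  have tV: "?t ?V = four_block_mat (1\<^sub>m r) (?t L) (0\<^sub>m k r) (?t T)"
    using L Tc by (subst transpose_four_block_mat[of _ r r _ k _ k]) auto
  have assoc: "?t ?V * M * ?V = ?t ?V * (M * ?V)" if "M \<in> carrier_mat (r + k) (r + k)" for M
    using that Vc by (intro assoc_mult_mat[of _ "r + k" "r + k" _ "r + k" _ "r + k"]) (simp_all only: transpose_carrier_mat)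
  {
    fix A :: "real Matrix.mat" assume A: "A \<in> carrier_mat r r"
    let ?M = "four_block_mat A B (?t B) D"
    have Mc: "?M \<in> carrier_mat (r + k) (r + k)" using A D by auto
    have "?M * ?V = four_block_mat (A * 1\<^sub>m r + B * L) (A * 0\<^sub>m r k + B * T)
        (?t B * 1\<^sub>m r + D * L) (?t B * 0\<^sub>m r k + D * T)"
      by (rule mult_four_block_mat[of _ r r _ k _ k _ _ r _ k]) (use A B BT D L Tc in auto)
    also have "A * 1\<^sub>m r + B * L = A - H"
      using A B L unfolding H_def by (intro eq_matI) auto
    also have "A * 0\<^sub>m r k + B * T = B * T" using A B Tc by simp
    also have "?t B * 1\<^sub>m r + D * L = 0\<^sub>m k r"
      unfolding DL using BT by (intro eq_matI) auto
    also have "?t B * 0\<^sub>m r k + D * T = D * T" using BT D Tc by simp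
    finally have MV: "?M * ?V = four_block_mat (A - H) (B * T) (0\<^sub>m k r) (D * T)" .
    have "?t ?V * (?M * ?V) = four_block_mat (1\<^sub>m r * (A - H) + ?t L * 0\<^sub>m k r)
        (1\<^sub>m r * (B * T) + ?t L * (D * T)) (0\<^sub>m k r * (A - H) + ?t T * 0\<^sub>m k r)
        (0\<^sub>m k r * (B * T) + ?t T * (D * T))"
      unfolding MV tV
      by (rule mult_four_block_mat[of _ r r _ k _ k _ _ r _ k]) (use A B D L Tc Hc in auto)
    also have "1\<^sub>m r * (A - H) + ?t L * 0\<^sub>m k r = A - H" using A Hc LTc by auto
    also have "1\<^sub>m r * (B * T) + ?t L * (D * T) = 0\<^sub>m r k"
    proof -
      have "?t L * (D * T) = (?t L * D) * T"
        using LTc D Tc by (intro assoc_mult_mat[of _ r k _ k _ k, symmetric]) auto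
      also have "?t L * D = ?t (D * L)" using D L by (subst transpose_mult[of _ k k _ r]) auto
      also have "\<dots> = - B" unfolding DL transpose_uminus by simp
      also have "- B * T = - (B * T)" using B Tc by simp
      finally have LDT: "?t L * (D * T) = - (B * T)" .
      have BTc: "B * T \<in> carrier_mat r k" using B Tc by simp
      show ?thesis unfolding LDT left_mult_one_mat[OF BTc]
        using BTc by (subst comm_add_mat[of _ r k]) auto
    qed
    also have "0\<^sub>m k r * (A - H) + ?t T * 0\<^sub>m k r = 0\<^sub>m k r" using A Hc TTc by auto
    also have "0\<^sub>m k r * (B * T) + ?t T * (D * T) = 1\<^sub>m k" unfolding TDT using B Tc by auto
    finally show "cong_mat ?V ?M = dsum (A - H) (1\<^sub>m k)"
      unfolding cong_mat_def assoc[OF Mc] using A Hc by (subst dsum_eq[of _ r _ k]) auto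
  }
  fix Z :: "real Matrix.mat" assume Z: "Z \<in> carrier_mat r r"
  have Zc: "dsum Z (0\<^sub>m k k) \<in> carrier_mat (r + k) (r + k)" using Z by auto
  have d: "dsum Z (0\<^sub>m k k) = four_block_mat Z (0\<^sub>m r k) (0\<^sub>m k r) (0\<^sub>m k k)"
    using Z by (rule dsum_eq) simp
  have "dsum Z (0\<^sub>m k k) * ?V = dsum Z (0\<^sub>m k k)"
    unfolding d using Z L Tc by (subst mult_four_block_mat[of _ r r _ k _ k _ _ r _ k]) auto
  moreover have "?t ?V * dsum Z (0\<^sub>m k k) = dsum Z (0\<^sub>m k k)"
    unfolding d tV using Z LTc TTc by (subst mult_four_block_mat[of _ r r _ k _ k _ _ r _ k]) auto
  ultimately show "cong_mat ?V (dsum Z (0\<^sub>m k k)) = dsum Z (0\<^sub>m k k)"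
    unfolding cong_mat_def assoc[OF Zc] by simp
qed

section \<open>Normal forms\<close>

lemma psd_mat_dsumD:
  assumes A: "A \<in> carrier_mat n n" and B: "B \<in> carrier_mat m m" and p: "psd_mat (n + m) (dsum A B)"
  shows "psd_mat n A"
  unfolding psd_mat_def
proof (intro conjI ballI)
  show "A \<in> carrier_mat n n" by (rule A)
  have "dsum (transpose_mat A) (transpose_mat B) = dsum A B"
    using p A B unfolding psd_mat_def
    by (simp add: dsum_eq[of _ n _ m] transpose_four_block_mat[of _ n n _ m _ m])
  then show "transpose_mat A = A"
  proof (intro eq_matI)
    fix i j assume "i < dim_row A" "j < dim_col A"
    then show "transpose_mat A $$ (i, j) = A $$ (i, j)"
      using arg_cong[OF \<open>dsum (transpose_mat A) (transpose_mat B) = dsum A B\<close>, of "\<lambda>M. M $$ (i, j)"] A B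
      unfolding dsum_def by auto
  qed (use A in auto)
  fix v :: "real Matrix.vec" assume v: "v \<in> carrier_vec n"
  have "(v @\<^sub>v 0\<^sub>v m) \<bullet> (dsum A B *\<^sub>v (v @\<^sub>v 0\<^sub>v m)) = v \<bullet> (A *\<^sub>v v)"
    using A B v by (subst dsum_mult_vec) (auto simp: scalar_prod_append[of _ n _ m])
  moreover have "v @\<^sub>v 0\<^sub>v m \<in> carrier_vec (n + m)" using v by auto
  ultimately show "v \<bullet> (A *\<^sub>v v) \<ge> 0" using p unfolding psd_mat_def by force
qed

lemma spd_mat_dsumD:
  assumes A: "A \<in> carrier_mat n n" and B: "B \<in> carrier_mat m m" and p: "spd_mat (n + m) (dsum A B)"
  shows "spd_mat n A"
proof (rule psd_mat_spdI)
  show "psd_mat n A" by (rule psd_mat_dsumD[OF A B spd_imp_psd[OF p]])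
  fix v :: "real Matrix.vec" assume v: "v \<in> carrier_vec n" "A *\<^sub>v v = 0\<^sub>v n"
  have "dsum A B *\<^sub>v (v @\<^sub>v 0\<^sub>v m) = 0\<^sub>v (n + m)"
    unfolding dsum_mult_vec[OF A B v(1) zero_carrier_vec] v(2) mult_zero_vec[OF B] by (rule zero_vec_append)
  then have "v @\<^sub>v 0\<^sub>v m = 0\<^sub>v (n + m)"
    by (rule spd_mat_kernel[OF p append_carrier_vec[OF v(1) zero_carrier_vec]])
  then show "v = 0\<^sub>v n" by (rule append_vec_zeroD(1)[OF v(1)])
qed

lemma symmetric_split:
  assumes M: "M \<in> carrier_mat (n + m) (n + m)" and s: "transpose_mat M = M"
  obtains A B D where "A \<in> carrier_mat n n" "B \<in> carrier_mat n m" "D \<in> carrier_mat m m"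
    "transpose_mat A = A" "transpose_mat D = D" "M = four_block_mat A B (transpose_mat B) D"
proof
  have sym: "M $$ (i, j) = M $$ (j, i)" if "i < n + m" "j < n + m" for i j
    using arg_cong[OF s, of "\<lambda>M. M $$ (i, j)"] M that by auto
  let ?A = "Matrix.mat n n (\<lambda>(i, j). M $$ (i, j))"
  let ?B = "Matrix.mat n m (\<lambda>(i, j). M $$ (i, n + j))"
  let ?D = "Matrix.mat m m (\<lambda>(i, j). M $$ (n + i, n + j))"
  show "?A \<in> carrier_mat n n" "?B \<in> carrier_mat n m" "?D \<in> carrier_mat m m" by auto
  show "transpose_mat ?A = ?A" by (intro eq_matI) (auto intro: sym)
  show "transpose_mat ?D = ?D" by (intro eq_matI) (auto intro: sym)
  show "M = four_block_mat ?A ?B (transpose_mat ?B) ?D"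
  proof (intro eq_matI)
    fix i j assume "i < dim_row (four_block_mat ?A ?B (transpose_mat ?B) ?D)"
      "j < dim_col (four_block_mat ?A ?B (transpose_mat ?B) ?D)"
    then show "M $$ (i, j) = four_block_mat ?A ?B (transpose_mat ?B) ?D $$ (i, j)"
      using sym[of i j] by (auto simp: not_less)
  qed (use M in auto)
qed

lemma cong_mat_kernel:
  assumes W: "nonsing n W" and A: "A \<in> carrier_mat n n" and v: "v \<in> carrier_vec n"
  shows "cong_mat W A *\<^sub>v v = 0\<^sub>v n \<longleftrightarrow> A *\<^sub>v (W *\<^sub>v v) = 0\<^sub>v n"
proof -
  have c: "A *\<^sub>v (W *\<^sub>v v) \<in> carrier_vec n" using A v nonsing_carrier[OF W] by auto
  have "transpose_mat W *\<^sub>v 0\<^sub>v n = 0\<^sub>v n"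
    by (rule mult_zero_vec[OF nonsing_carrier[OF nonsing_transpose[OF W]]])
  then show ?thesis
    unfolding cong_mat_mult_vec[OF nonsing_carrier[OF W] A v]
    using nonsing_inj[OF nonsing_transpose[OF W] c] by metis
qed

lemma nonsing_if_cong_one:
  assumes T: "T \<in> carrier_mat n n" and D: "D \<in> carrier_mat n n" and eq: "cong_mat T D = 1\<^sub>m n"
  shows "nonsing n T"
proof -
  have TD: "transpose_mat T * D \<in> carrier_mat n n" using T D by auto
  have "Determinant.det (transpose_mat T * D) * Determinant.det T = 1"
    unfolding det_mult[OF TD T, symmetric] cong_mat_def[symmetric] eq by simp
  then have "Determinant.det T \<noteq> 0" by auto
  then show ?thesis using T unfolding nonsing_def by auto
qed

lemma zero_smult_one: "0 \<cdot>\<^sub>m 1\<^sub>m n = (0\<^sub>m n n :: real Matrix.mat)"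
  by (intro eq_matI) auto

text \<open>Sylvester's law for semidefinite matrices, by induction on the size, removing the last row and
  column. If the last diagonal entry vanishes, the last unit vector is isotropic, hence in the kernel,
  and the last row and column are zero. Otherwise the entry is positive and elimination splits it off.\<close>

lemma psd_normal_form:
  "psd_mat n A \<Longrightarrow> \<exists>r k W. r + k = n \<and> nonsing n W \<and> cong_mat W A = dsum (1\<^sub>m r) (0\<^sub>m k k)"
proof (induction n arbitrary: A)
  case 0
  have c: "cong_mat (1\<^sub>m 0) A \<in> carrier_mat 0 0"
    using 0 unfolding psd_mat_def by (intro cong_mat_carrier) auto
  have "cong_mat (1\<^sub>m 0) A = dsum (1\<^sub>m 0) (0\<^sub>m 0 0)"
    by (rule eq_matI) (use c in \<open>simp_all add: dsum_def\<close>)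
  then show ?case using nonsing_one[of 0] by (metis add_0)
next
  case (Suc n)
  have Ac: "A \<in> carrier_mat (n + 1) (n + 1)" and As: "transpose_mat A = A"
    using Suc.prems unfolding psd_mat_def by auto
  obtain A' B D where A': "A' \<in> carrier_mat n n" and B: "B \<in> carrier_mat n 1"
    and D: "D \<in> carrier_mat 1 1" and "transpose_mat A' = A'" and Ds: "transpose_mat D = D"
    and A: "A = four_block_mat A' B (transpose_mat B) D"
    by (rule symmetric_split[OF Ac As])
  define d where "d = D $$ (0, 0)"
  let ?u = "unit_vec 1 0 :: real Matrix.vec"
  let ?e = "0\<^sub>v n @\<^sub>v ?u"
  have e: "?e \<in> carrier_vec (Suc n)" using append_carrier_vec[of "0\<^sub>v n" n ?u 1] by simp
  have Ae: "A *\<^sub>v ?e = (B *\<^sub>v ?u) @\<^sub>v (D *\<^sub>v ?u)"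
    unfolding A using A' B D by (intro four_block_mult_lower) auto
  have form: "?e \<bullet> (A *\<^sub>v ?e) = d"
    unfolding Ae d_def using B D by (subst scalar_prod_append[of _ n _ 1]) auto
  have "d \<ge> 0" using Suc.prems e unfolding psd_mat_def form[symmetric] by blast
  (* Both cases reduce to a block of size n next to a single entry c, which is 0 or 1 and
     joins the zero block or the identity block of the smaller matrix. *)
  have extend: ?case
    if V: "nonsing (Suc n) V" "cong_mat V A = dsum M (c \<cdot>\<^sub>m 1\<^sub>m 1)" and M: "M \<in> carrier_mat n n"
      and c: "c = 0 \<or> c = 1" for V M and c :: real
  proof -
    have one: "c \<cdot>\<^sub>m 1\<^sub>m 1 \<in> carrier_mat 1 1" by simp
    have "psd_mat (n + 1) (dsum M (c \<cdot>\<^sub>m 1\<^sub>m 1))"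
      using psd_mat_cong[OF nonsing_carrier[OF V(1)] Suc.prems] unfolding V(2) by simp
    from psd_mat_dsumD[OF M one this] obtain r k W where rk: "r + k = n" and W: "nonsing n W"
      and WM: "cong_mat W M = dsum (1\<^sub>m r) (0\<^sub>m k k)"
      using Suc.IH by blast
    let ?W = "dsum W (1\<^sub>m 1)"
    have nW: "nonsing (Suc n) ?W" using nonsing_dsum[OF W nonsing_one[of 1]] by simp
    have "cong_mat (1\<^sub>m 1) (c \<cdot>\<^sub>m 1\<^sub>m 1) = c \<cdot>\<^sub>m (1\<^sub>m 1 :: real Matrix.mat)" unfolding cong_mat_def by simp
    then have c2: "cong_mat (V * ?W) A = dsum (dsum (1\<^sub>m r) (0\<^sub>m k k)) (c \<cdot>\<^sub>m 1\<^sub>m 1)"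
      using cong_mat_comp[OF nonsing_carrier[OF V(1)] nonsing_carrier[OF nW], of A] Ac
        cong_mat_dsum[OF nonsing_carrier[OF W] _ M one, of "1\<^sub>m 1"]
      unfolding V(2) WM by simp
    have nVW: "nonsing (Suc n) (V * ?W)" by (rule nonsing_mult[OF V(1) nW])
    show ?case
    proof (cases "c = 0")
      case True
      then have "dsum (dsum (1\<^sub>m r) (0\<^sub>m k k)) (c \<cdot>\<^sub>m 1\<^sub>m 1) = dsum (1\<^sub>m r) (0\<^sub>m (k + 1) (k + 1))"
        unfolding True dsum_assoc dsum_zero[symmetric] by (subst zero_smult_one) (rule refl)
      then show ?thesis using c2 nVW rk by (intro exI[of _ r] exI[of _ "k + 1"] exI[of _ "V * ?W"] conjI) simp_all
    next
      case False
      then have c1: "c \<cdot>\<^sub>m 1\<^sub>m 1 = (1\<^sub>m 1 :: real Matrix.mat)" using c by auto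
      have rkc: "dsum (1\<^sub>m r) (0\<^sub>m k k) \<in> carrier_mat n n" using rk dsum_carrier[of "1\<^sub>m r" r "0\<^sub>m k k" k] by auto
      obtain Q where Q: "nonsing (n + 1) Q"
        "cong_mat Q (dsum (dsum (1\<^sub>m r) (0\<^sub>m k k)) (1\<^sub>m 1)) = dsum (1\<^sub>m 1) (dsum (1\<^sub>m r) (0\<^sub>m k k))"
        by (rule dsum_swap[OF rkc one_carrier_mat[of 1]])
      have "cong_mat (V * ?W * Q) A = dsum (1\<^sub>m (1 + r)) (0\<^sub>m k k)"
        using cong_mat_comp[of "V * ?W" "n + 1" "n + 1" Q "n + 1" A] nonsing_carrier[OF nVW] nonsing_carrier[OF Q(1)] Ac
          Q(2) unfolding c2 c1 dsum_assoc[symmetric] dsum_one by simp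
      moreover have "nonsing (Suc n) (V * ?W * Q)" using nonsing_mult[OF nVW] Q(1) by simp
      ultimately show ?thesis using rk by (intro exI[of _ "1 + r"] exI[of _ k] exI[of _ "V * ?W * Q"] conjI) simp_all
    qed
  qed
  show ?case
  proof (cases "d = 0")
    case True
    then have "A *\<^sub>v ?e = 0\<^sub>v (Suc n)" using psd_mat_kernel[OF Suc.prems e] form by simp
    then have Bu: "B *\<^sub>v ?u = 0\<^sub>v n"
      using append_vec_zeroD(1)[of "B *\<^sub>v ?u" n "D *\<^sub>v ?u" 1] B unfolding Ae by simp
    have "B = 0\<^sub>m n 1"
    proof (intro eq_matI)
      fix i j assume "i < dim_row (0\<^sub>m n 1 :: real Matrix.mat)" "j < dim_col (0\<^sub>m n 1 :: real Matrix.mat)"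
      then show "B $$ (i, j) = 0\<^sub>m n 1 $$ (i, j)" using B arg_cong[OF Bu, of "\<lambda>v. vec_index v i"] by auto
    qed (use B in auto)
    moreover have D0: "D = 0 \<cdot>\<^sub>m 1\<^sub>m 1" using True D unfolding d_def by (intro eq_matI) auto
    ultimately have "A = dsum A' (0 \<cdot>\<^sub>m 1\<^sub>m 1)"
      unfolding A using A' by (subst dsum_eq[of _ n _ 1]) auto
    moreover have "cong_mat (1\<^sub>m (Suc n)) A = A" using Ac unfolding cong_mat_def by simp
    ultimately show ?thesis using extend[OF nonsing_one _ A', of 0] by simp
  next
    case False
    with \<open>d \<ge> 0\<close> have dpos: "d > 0" by simp
    let ?T = "Matrix.mat 1 1 (\<lambda>_. 1 / sqrt d)"
    have Tc: "?T \<in> carrier_mat 1 1" by simp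
    have TD: "cong_mat ?T D = 1\<^sub>m 1"
      using D dpos unfolding cong_mat_def
      by (intro eq_matI) (auto simp: scalar_prod_def d_def[symmetric] field_simps)
    obtain V H where V: "nonsing (n + 1) V" and H: "H \<in> carrier_mat n n"
      and VA: "\<And>A. A \<in> carrier_mat n n \<Longrightarrow>
        cong_mat V (four_block_mat A B (transpose_mat B) D) = dsum (A - H) (1\<^sub>m 1)"
      and "\<And>Z. Z \<in> carrier_mat n n \<Longrightarrow> cong_mat V (dsum Z (0\<^sub>m 1 1)) = dsum Z (0\<^sub>m 1 1)"
      by (rule block_elimination[OF B D Ds nonsing_if_cong_one[OF Tc D TD] TD]) (rule that)
    have "cong_mat V A = dsum (A' - H) (1 \<cdot>\<^sub>m 1\<^sub>m 1)"
    proof -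
      have "1 \<cdot>\<^sub>m 1\<^sub>m 1 = (1\<^sub>m 1 :: real Matrix.mat)" by auto
      then show ?thesis using VA[OF A'] unfolding A by simp
    qed
    moreover have "A' - H \<in> carrier_mat n n" using A' H by auto
    ultimately show ?thesis using extend[of V "A' - H" 1] V by simp
  qed
qed

lemma spd_normal_form:
  assumes D: "spd_mat n D" shows "\<exists>T. nonsing n T \<and> cong_mat T D = 1\<^sub>m n"
proof -
  obtain r k T where rk: "r + k = n" and T: "nonsing n T" and TD: "cong_mat T D = dsum (1\<^sub>m r) (0\<^sub>m k k)"
    using psd_normal_form[OF spd_imp_psd[OF D]] by blast
  have spd: "spd_mat n (dsum (1\<^sub>m r) (0\<^sub>m k k))"
    using spd_mat_cong[OF nonsing_carrier[OF T] D nonsing_inj[OF T]] unfolding TD .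
  have "k = 0"
  proof (rule ccontr)
    assume "k \<noteq> 0"
    have "dsum (1\<^sub>m r) (0\<^sub>m k k) *\<^sub>v (0\<^sub>v r @\<^sub>v unit_vec k 0) = 0\<^sub>v r @\<^sub>v 0\<^sub>v k"
      by (subst dsum_mult_vec[of _ r _ k]) auto
    then have "0\<^sub>v r @\<^sub>v unit_vec k 0 = (0\<^sub>v (r + k) :: real Matrix.vec)"
      using spd unfolding zero_vec_append rk[symmetric] by (rule spd_mat_kernel[rotated 2]) auto
    then have "unit_vec k 0 = (0\<^sub>v k :: real Matrix.vec)" by (rule append_vec_zeroD(2)[rotated]) simp
    from arg_cong[OF this, of "\<lambda>v. vec_index v 0"] show False using \<open>k \<noteq> 0\<close> by simp
  qed
  moreover have "dsum (1\<^sub>m n) (0\<^sub>m 0 0) = 1\<^sub>m n" unfolding dsum_def by (intro eq_matI) auto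
  ultimately show ?thesis using T TD rk by auto
qed

text \<open>Sylvester's normal form supplies the matrix \<open>T\<close> that elimination asks for, once the block is definite.\<close>

lemma schur_reduction:
  assumes B: "B \<in> carrier_mat r k" and D: "spd_mat k D"
  obtains V H where "nonsing (r + k) V" "H \<in> carrier_mat r r"
    "\<And>A. A \<in> carrier_mat r r \<Longrightarrow>
       cong_mat V (four_block_mat A B (transpose_mat B) D) = dsum (A - H) (1\<^sub>m k)"
    "\<And>Z. Z \<in> carrier_mat r r \<Longrightarrow> cong_mat V (dsum Z (0\<^sub>m k k)) = dsum Z (0\<^sub>m k k)"
proof -
  obtain T where T: "nonsing k T" "cong_mat T D = 1\<^sub>m k" using spd_normal_form[OF D] by blast
  have "D \<in> carrier_mat k k" "transpose_mat D = D" using D unfolding spd_mat_def by auto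
  note elim = block_elimination[OF B this T]
  show thesis by (rule elim) (rule that)
qed

section \<open>Families of semidefinite matrices\<close>

text \<open>A basis adapted to the kernel of one member of the family is adapted to the kernel of every member,
  because the kernels agree; on the complementary block each member is semidefinite with
  trivial kernel, hence definite.\<close>

lemma common_kernel_reduction:
  assumes I: "x0 \<in> I" and psd: "\<And>x. x \<in> I \<Longrightarrow> psd_mat n (S x)"
    and ker: "\<And>x y v. x \<in> I \<Longrightarrow> y \<in> I \<Longrightarrow> v \<in> carrier_vec n \<Longrightarrow> S x *\<^sub>v v = 0\<^sub>v n \<Longrightarrow> S y *\<^sub>v v = 0\<^sub>v n"
  shows "\<exists>s z U Q. s + z = n \<and> nonsing n U \<and>
    (\<forall>x\<in>I. spd_mat s (Q x) \<and> cong_mat U (S x) = dsum (Q x) (0\<^sub>m z z))"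
proof -
  obtain s z U where sz: "s + z = n" and U: "nonsing n U"
    and US: "cong_mat U (S x0) = dsum (1\<^sub>m s) (0\<^sub>m z z)"
    using psd_normal_form[OF psd[OF I]] by blast
  note Uc = nonsing_carrier[OF U]
  have Sc: "S x \<in> carrier_mat n n" if "x \<in> I" for x using psd[OF that] unfolding psd_mat_def by blast
  have ker': "cong_mat U (S y) *\<^sub>v v = 0\<^sub>v n"
    if "x \<in> I" "y \<in> I" "v \<in> carrier_vec n" "cong_mat U (S x) *\<^sub>v v = 0\<^sub>v n" for x y v
  proof -
    have "U *\<^sub>v v \<in> carrier_vec n" using Uc that(3) by auto
    then have "S y *\<^sub>v (U *\<^sub>v v) = 0\<^sub>v n"
      using ker[OF that(1,2)] that(4) unfolding cong_mat_kernel[OF U Sc[OF that(1)] that(3)] by blast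
    then show ?thesis unfolding cong_mat_kernel[OF U Sc[OF that(2)] that(3)] .
  qed
  have "\<exists>Q. spd_mat s Q \<and> cong_mat U (S x) = dsum Q (0\<^sub>m z z)" if x: "x \<in> I" for x
  proof -
    have pM: "psd_mat (s + z) (cong_mat U (S x))"
      using psd_mat_cong[OF Uc psd[OF x]] unfolding sz .
    then have Mc: "cong_mat U (S x) \<in> carrier_mat (s + z) (s + z)"
      and Ms: "transpose_mat (cong_mat U (S x)) = cong_mat U (S x)"
      unfolding psd_mat_def by blast+
    obtain A B D where A: "A \<in> carrier_mat s s" and B: "B \<in> carrier_mat s z" and D: "D \<in> carrier_mat z z"
      and "transpose_mat A = A" "transpose_mat D = D"
      and M: "cong_mat U (S x) = four_block_mat A B (transpose_mat B) D"
      by (rule symmetric_split[OF Mc Ms])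
    have BT: "transpose_mat B \<in> carrier_mat z s" using B by simp
    have low: "B *\<^sub>v w = 0\<^sub>v s" "D *\<^sub>v w = 0\<^sub>v z" if w: "w \<in> carrier_vec z" for w
    proof -
      have e: "0\<^sub>v s @\<^sub>v w \<in> carrier_vec n"
        using append_carrier_vec[OF zero_carrier_vec w, of s] unfolding sz .
      have "dsum (1\<^sub>m s) (0\<^sub>m z z) *\<^sub>v (0\<^sub>v s @\<^sub>v w) = (1\<^sub>m s *\<^sub>v 0\<^sub>v s) @\<^sub>v (0\<^sub>m z z *\<^sub>v w)"
        by (rule dsum_mult_vec[OF _ _ _ w]) auto
      also have "(0\<^sub>m z z *\<^sub>v w) = 0\<^sub>v z" using w by auto
      also have "1\<^sub>m s *\<^sub>v 0\<^sub>v s = (0\<^sub>v s :: real Matrix.vec)" by simp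
      finally have "cong_mat U (S x0) *\<^sub>v (0\<^sub>v s @\<^sub>v w) = 0\<^sub>v n" unfolding US zero_vec_append sz .
      then have "cong_mat U (S x) *\<^sub>v (0\<^sub>v s @\<^sub>v w) = 0\<^sub>v n" by (rule ker'[OF I x e])
      then have z: "(B *\<^sub>v w) @\<^sub>v (D *\<^sub>v w) = 0\<^sub>v (s + z)"
        unfolding M four_block_mult_lower[OF A B BT D w] sz .
      have "B *\<^sub>v w \<in> carrier_vec s" using B w by auto
      from append_vec_zeroD[OF this z] show "B *\<^sub>v w = 0\<^sub>v s" "D *\<^sub>v w = 0\<^sub>v z" .
    qed
    have B0: "B = 0\<^sub>m s z" by (rule mat_eqI_mult_vec[OF B zero_carrier_mat]) (use low in auto)
    have D0: "D = 0\<^sub>m z z" by (rule mat_eqI_mult_vec[OF D zero_carrier_mat]) (use low in auto)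
    have M': "cong_mat U (S x) = dsum A (0\<^sub>m z z)"
      unfolding M B0 D0 dsum_eq[OF A zero_carrier_mat] by simp
    have "spd_mat s A"
    proof (rule psd_mat_spdI)
      show "psd_mat s A" by (rule psd_mat_dsumD[OF A zero_carrier_mat pM[unfolded M']])
      fix v :: "real Matrix.vec" assume v: "v \<in> carrier_vec s" "A *\<^sub>v v = 0\<^sub>v s"
      have e: "v @\<^sub>v 0\<^sub>v z \<in> carrier_vec n"
        using append_carrier_vec[OF v(1) zero_carrier_vec, of z] unfolding sz .
      have zz: "0\<^sub>m z z *\<^sub>v 0\<^sub>v z = (0\<^sub>v z :: real Matrix.vec)" by (rule mult_zero_vec) simp
      have "dsum A (0\<^sub>m z z) *\<^sub>v (v @\<^sub>v 0\<^sub>v z) = 0\<^sub>v n"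
        unfolding dsum_mult_vec[OF A zero_carrier_mat v(1) zero_carrier_vec] v(2) zz zero_vec_append sz ..
      then have "cong_mat U (S x0) *\<^sub>v (v @\<^sub>v 0\<^sub>v z) = 0\<^sub>v n"
        unfolding M'[symmetric] by (rule ker'[OF x I e])
      then have "v @\<^sub>v 0\<^sub>v z = 0\<^sub>v (s + z)"
        unfolding US dsum_mult_vec[OF one_carrier_mat zero_carrier_mat v(1) zero_carrier_vec] zz
          one_mult_mat_vec[OF v(1)] sz .
      then show "v = 0\<^sub>v s" by (rule append_vec_zeroD(1)[OF v(1)])
    qed
    with M' show ?thesis by blast
  qed
  then obtain Q where "\<forall>x\<in>I. spd_mat s (Q x) \<and> cong_mat U (S x) = dsum (Q x) (0\<^sub>m z z)"
    by metis
  then show ?thesis using sz U by blast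
qed

text \<open>In a basis adapted to the kernel of \<open>E\<close>, constancy of \<open>S x\<close> on that kernel says that all blocks of
  \<open>S x\<close> other than the upper left one are independent of \<open>x\<close>, and regularity says that the lower right
  one is definite. A single elimination step then splits off the kernel for all \<open>x\<close> at once. It does not
  affect the normal form of \<open>E\<close>, which lives on the first block.\<close>

lemma kernel_split_off:
  assumes I: "x0 \<in> I" and E: "psd_mat n E" and psd: "\<And>x. x \<in> I \<Longrightarrow> psd_mat n (S x)"
    and const: "\<And>x y v. x \<in> I \<Longrightarrow> y \<in> I \<Longrightarrow> v \<in> carrier_vec n \<Longrightarrow> E *\<^sub>v v = 0\<^sub>v n \<Longrightarrow> S x *\<^sub>v v = S y *\<^sub>v v"
    and regular: "\<And>x v. x \<in> I \<Longrightarrow> v \<in> carrier_vec n \<Longrightarrow> E *\<^sub>v v = 0\<^sub>v n \<Longrightarrow> S x *\<^sub>v v = 0\<^sub>v n \<Longrightarrow> v = 0\<^sub>v n"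
  shows "\<exists>r k W A. r + k = n \<and> nonsing n W \<and> cong_mat W E = dsum (1\<^sub>m r) (0\<^sub>m k k) \<and>
    (\<forall>x\<in>I. A x \<in> carrier_mat r r \<and> cong_mat W (S x) = dsum (A x) (1\<^sub>m k))"
proof -
  obtain r k W where rk: "r + k = n" and W: "nonsing n W"
    and WE: "cong_mat W E = dsum (1\<^sub>m r) (0\<^sub>m k k)"
    using psd_normal_form[OF E] by blast
  note Wc = nonsing_carrier[OF W]
  have Ec: "E \<in> carrier_mat n n" using E unfolding psd_mat_def by blast
  have Sc: "S x \<in> carrier_mat n n" if "x \<in> I" for x using psd[OF that] unfolding psd_mat_def by blast
  have psdM: "psd_mat (r + k) (cong_mat W (S x))" if "x \<in> I" for x
    using psd_mat_cong[OF Wc psd[OF that]] unfolding rk .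
  have "\<exists>A B D. A \<in> carrier_mat r r \<and> B \<in> carrier_mat r k \<and> D \<in> carrier_mat k k \<and>
      transpose_mat D = D \<and> cong_mat W (S x) = four_block_mat A B (transpose_mat B) D" if "x \<in> I" for x
  proof -
    have Mc: "cong_mat W (S x) \<in> carrier_mat (r + k) (r + k)"
      and Ms: "transpose_mat (cong_mat W (S x)) = cong_mat W (S x)"
      using psdM[OF that] unfolding psd_mat_def by blast+
    show ?thesis by (rule symmetric_split[OF Mc Ms]) blast
  qed
  then obtain A B D where blocks: "\<And>x. x \<in> I \<Longrightarrow> A x \<in> carrier_mat r r"
      "\<And>x. x \<in> I \<Longrightarrow> B x \<in> carrier_mat r k" "\<And>x. x \<in> I \<Longrightarrow> D x \<in> carrier_mat k k"
      "\<And>x. x \<in> I \<Longrightarrow> transpose_mat (D x) = D x"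
    and M: "\<And>x. x \<in> I \<Longrightarrow> cong_mat W (S x) = four_block_mat (A x) (B x) (transpose_mat (B x)) (D x)"
    by metis
  have BT: "transpose_mat (B x) \<in> carrier_mat k r" if "x \<in> I" for x using blocks(2)[OF that] by simp
  have low: "cong_mat W (S x) *\<^sub>v (0\<^sub>v r @\<^sub>v w) = (B x *\<^sub>v w) @\<^sub>v (D x *\<^sub>v w)"
    if "x \<in> I" "w \<in> carrier_vec k" for x w
    unfolding M[OF that(1)] by (rule four_block_mult_lower[OF blocks(1-2) BT blocks(3) that(2)]) (use that in auto)
  have ec: "0\<^sub>v r @\<^sub>v w \<in> carrier_vec n" if "w \<in> carrier_vec k" for w :: "real Matrix.vec"
    using append_carrier_vec[OF zero_carrier_vec that, of r] unfolding rk .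
  have Wec: "W *\<^sub>v (0\<^sub>v r @\<^sub>v w) \<in> carrier_vec n" if "w \<in> carrier_vec k" for w
    using Wc ec[OF that] by auto
  have Eker: "E *\<^sub>v (W *\<^sub>v (0\<^sub>v r @\<^sub>v w)) = 0\<^sub>v n" if w: "w \<in> carrier_vec k" for w
  proof -
    have "dsum (1\<^sub>m r) (0\<^sub>m k k) *\<^sub>v (0\<^sub>v r @\<^sub>v w) = (1\<^sub>m r *\<^sub>v 0\<^sub>v r) @\<^sub>v (0\<^sub>m k k *\<^sub>v w)"
      by (rule dsum_mult_vec[OF _ _ _ w]) auto
    also have "(0\<^sub>m k k *\<^sub>v w) = 0\<^sub>v k" using w by auto
    also have "1\<^sub>m r *\<^sub>v 0\<^sub>v r = (0\<^sub>v r :: real Matrix.vec)" by simp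
    finally have "cong_mat W E *\<^sub>v (0\<^sub>v r @\<^sub>v w) = 0\<^sub>v n" unfolding WE zero_vec_append rk .
    then show ?thesis unfolding cong_mat_kernel[OF W Ec ec[OF w]] .
  qed
  have BD: "B x *\<^sub>v w = B x0 *\<^sub>v w \<and> D x *\<^sub>v w = D x0 *\<^sub>v w" if x: "x \<in> I" and w: "w \<in> carrier_vec k" for x w
  proof -
    have "cong_mat W (S x) *\<^sub>v (0\<^sub>v r @\<^sub>v w) = cong_mat W (S x0) *\<^sub>v (0\<^sub>v r @\<^sub>v w)"
      unfolding cong_mat_mult_vec[OF Wc Sc[OF x] ec[OF w]] cong_mat_mult_vec[OF Wc Sc[OF I] ec[OF w]]
        const[OF x I Wec[OF w] Eker[OF w]] ..
    then have eq: "(B x *\<^sub>v w) @\<^sub>v (D x *\<^sub>v w) = (B x0 *\<^sub>v w) @\<^sub>v (D x0 *\<^sub>v w)"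
      unfolding low[OF x w] low[OF I w] .
    have c: "B x *\<^sub>v w \<in> carrier_vec r" "B x0 *\<^sub>v w \<in> carrier_vec r"
      using blocks(2)[OF x] blocks(2)[OF I] w by auto
    from eq show ?thesis unfolding append_vec_eq[OF c] .
  qed
  have B0: "B x = B x0" if "x \<in> I" for x
    by (rule mat_eqI_mult_vec[OF blocks(2)[OF that] blocks(2)[OF I]]) (use BD[OF that] in blast)
  have D0: "D x = D x0" if "x \<in> I" for x
    by (rule mat_eqI_mult_vec[OF blocks(3)[OF that] blocks(3)[OF I]]) (use BD[OF that] in blast)
  have "spd_mat k (D x0)"
    unfolding spd_mat_def
  proof (intro conjI ballI impI)
    show "D x0 \<in> carrier_mat k k" "transpose_mat (D x0) = D x0" using blocks I by auto
    fix w :: "real Matrix.vec" assume w: "w \<in> carrier_vec k" "w \<noteq> 0\<^sub>v k"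
    let ?e = "0\<^sub>v r @\<^sub>v w"
    have "S x0 *\<^sub>v (W *\<^sub>v ?e) \<noteq> 0\<^sub>v n"
    proof
      assume "S x0 *\<^sub>v (W *\<^sub>v ?e) = 0\<^sub>v n"
      from regular[OF I Wec[OF w(1)] Eker[OF w(1)] this] have "?e = 0\<^sub>v n" by (rule nonsing_inj[OF W ec[OF w(1)]])
      then have "w = 0\<^sub>v k" unfolding rk[symmetric] by (rule append_vec_zeroD(2)[OF zero_carrier_vec])
      then show False using w(2) by simp
    qed
    then have "cong_mat W (S x0) *\<^sub>v ?e \<noteq> 0\<^sub>v (r + k)"
      unfolding rk cong_mat_kernel[OF W Sc[OF I] ec[OF w(1)]] .
    moreover have er: "?e \<in> carrier_vec (r + k)" using ec[OF w(1)] unfolding rk .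
    ultimately have "?e \<bullet> (cong_mat W (S x0) *\<^sub>v ?e) \<noteq> 0" using psd_mat_kernel[OF psdM[OF I] er] by blast
    moreover have "?e \<bullet> (cong_mat W (S x0) *\<^sub>v ?e) \<ge> 0"
      using psdM[OF I] er unfolding psd_mat_def by blast
    moreover have "?e \<bullet> (cong_mat W (S x0) *\<^sub>v ?e) = w \<bullet> (D x0 *\<^sub>v w)"
      unfolding low[OF I w(1)] using blocks(2,3)[OF I] w
      by (subst scalar_prod_append[of _ r _ k]) auto
    ultimately show "w \<bullet> (D x0 *\<^sub>v w) > 0" by simp
  qed
  from schur_reduction[OF blocks(2)[OF I] this]
  obtain V H where V: "nonsing (r + k) V" and H: "H \<in> carrier_mat r r"
    and VA: "\<And>A. A \<in> carrier_mat r r \<Longrightarrow>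
       cong_mat V (four_block_mat A (B x0) (transpose_mat (B x0)) (D x0)) = dsum (A - H) (1\<^sub>m k)"
    and VZ: "\<And>Z. Z \<in> carrier_mat r r \<Longrightarrow> cong_mat V (dsum Z (0\<^sub>m k k)) = dsum Z (0\<^sub>m k k)"
    by blast
  note Vc = nonsing_carrier[OF V, unfolded rk]
  have "nonsing n (W * V)" by (rule nonsing_mult[OF W V[unfolded rk]])
  moreover have "cong_mat (W * V) E = dsum (1\<^sub>m r) (0\<^sub>m k k)"
    unfolding cong_mat_comp[OF Wc Vc Ec, symmetric] WE by (rule VZ) simp
  moreover have "A x - H \<in> carrier_mat r r \<and> cong_mat (W * V) (S x) = dsum (A x - H) (1\<^sub>m k)" if "x \<in> I" for x
    unfolding cong_mat_comp[OF Wc Vc Sc[OF that], symmetric] M[OF that] B0[OF that] D0[OF that]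
    using VA[OF blocks(1)[OF that]] H by (simp add: minus_carrier_mat)
  ultimately show ?thesis using rk
    by (intro exI[of _ r] exI[of _ k] exI[of _ "W * V"] exI[of _ "\<lambda>x. A x - H"] conjI ballI) blast+
qed

lemma spd_mat_lower_block:
  assumes A: "A \<in> carrier_mat n n" and B: "B \<in> carrier_mat n m" and D: "D \<in> carrier_mat m m"
    and Ds: "transpose_mat D = D" and spd: "spd_mat (n + m) (four_block_mat A B (transpose_mat B) D)"
  shows "spd_mat m D"
  unfolding spd_mat_def
proof (intro conjI ballI impI)
  show "D \<in> carrier_mat m m" "transpose_mat D = D" by (fact D, fact Ds)
  fix w :: "real Matrix.vec" assume w: "w \<in> carrier_vec m" "w \<noteq> 0\<^sub>v m"
  let ?e = "0\<^sub>v n @\<^sub>v w"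
  have BT: "transpose_mat B \<in> carrier_mat m n" using B by simp
  have e: "?e \<in> carrier_vec (n + m)" by (rule append_carrier_vec[OF zero_carrier_vec w(1)])
  have "?e \<noteq> 0\<^sub>v (n + m)" using append_vec_zeroD(2)[OF zero_carrier_vec] w(2) by blast
  then have "?e \<bullet> (four_block_mat A B (transpose_mat B) D *\<^sub>v ?e) > 0"
    using spd e unfolding spd_mat_def by blast
  moreover have "?e \<bullet> (four_block_mat A B (transpose_mat B) D *\<^sub>v ?e) = w \<bullet> (D *\<^sub>v w)"
    unfolding four_block_mult_lower[OF A B BT D w(1)] using B D w
    by (subst scalar_prod_append[of _ n _ m]) auto
  ultimately show "w \<bullet> (D *\<^sub>v w) > 0" by simp
qed

text \<open>After the kernel of \<open>E\<close> has been split off, \<open>E\<close> is the identity on the remaining space and the remaining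
  blocks \<open>A x\<close> of \<open>S x\<close> still share a kernel. A basis adapted to that kernel brings them to the form
  \<open>Q x \<oplus> 0\<close>, but turns the identity into some definite Gram matrix \<open>G\<close>. Eliminating against the definite
  lower block of \<open>G\<close> makes \<open>G\<close> block diagonal with an identity block, and preserves \<open>Q x \<oplus> 0\<close>.\<close>

theorem simultaneous_normal_form:
  assumes I: "x0 \<in> I" and E: "psd_mat n E" and psd: "\<And>x. x \<in> I \<Longrightarrow> psd_mat n (S x)"
    and ker: "\<And>x y v. x \<in> I \<Longrightarrow> y \<in> I \<Longrightarrow> v \<in> carrier_vec n \<Longrightarrow> S x *\<^sub>v v = 0\<^sub>v n \<Longrightarrow> S y *\<^sub>v v = 0\<^sub>v n"
    and const: "\<And>x y v. x \<in> I \<Longrightarrow> y \<in> I \<Longrightarrow> v \<in> carrier_vec n \<Longrightarrow> E *\<^sub>v v = 0\<^sub>v n \<Longrightarrow> S x *\<^sub>v v = S y *\<^sub>v v"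
    and regular: "\<And>x v. x \<in> I \<Longrightarrow> v \<in> carrier_vec n \<Longrightarrow> E *\<^sub>v v = 0\<^sub>v n \<Longrightarrow> S x *\<^sub>v v = 0\<^sub>v n \<Longrightarrow> v = 0\<^sub>v n"
  shows "\<exists>W ns n0 ninf E11 Q. nonsing n W \<and> ns + n0 + ninf = n \<and> spd_mat ns E11 \<and>
    cong_mat W E = dsum (dsum E11 (1\<^sub>m n0)) (0\<^sub>m ninf ninf) \<and>
    (\<forall>x\<in>I. spd_mat ns (Q x) \<and> cong_mat W (S x) = dsum (dsum (Q x) (0\<^sub>m n0 n0)) (1\<^sub>m ninf))"
proof -
  have "\<exists>r k W A. r + k = n \<and> nonsing n W \<and> cong_mat W E = dsum (1\<^sub>m r) (0\<^sub>m k k) \<and>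
    (\<forall>x\<in>I. A x \<in> carrier_mat r r \<and> cong_mat W (S x) = dsum (A x) (1\<^sub>m k))"
    by (rule kernel_split_off[of x0 I n E S]) (fact I, fact E, fact psd, fact const, fact regular)
  then obtain r k W A where rk: "r + k = n" and W: "nonsing n W"
    and WE: "cong_mat W E = dsum (1\<^sub>m r) (0\<^sub>m k k)"
    and WS: "\<forall>x\<in>I. A x \<in> carrier_mat r r \<and> cong_mat W (S x) = dsum (A x) (1\<^sub>m k)"
    by blast
  note Wc = nonsing_carrier[OF W]
  have Ec: "E \<in> carrier_mat n n" using E unfolding psd_mat_def by blast
  have Sc: "S x \<in> carrier_mat n n" if "x \<in> I" for x using psd[OF that] unfolding psd_mat_def by blast
  have Ac: "A x \<in> carrier_mat r r" and SA: "cong_mat W (S x) = dsum (A x) (1\<^sub>m k)" if "x \<in> I" for x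
    using WS that by auto
  have psdA: "psd_mat r (A x)" if "x \<in> I" for x
  proof -
    have "psd_mat (r + k) (dsum (A x) (1\<^sub>m k))"
      using psd_mat_cong[OF Wc psd[OF that]] unfolding SA[OF that] rk .
    then show ?thesis by (rule psd_mat_dsumD[OF Ac[OF that] one_carrier_mat])
  qed
  have kerA: "A y *\<^sub>v v = 0\<^sub>v r" if x: "x \<in> I" and y: "y \<in> I" and v: "v \<in> carrier_vec r" and z: "A x *\<^sub>v v = 0\<^sub>v r" for x y v
  proof -
    have e: "v @\<^sub>v 0\<^sub>v k \<in> carrier_vec n"
      using append_carrier_vec[OF v zero_carrier_vec, of k] unfolding rk .
    have mult: "cong_mat W (S x) *\<^sub>v (v @\<^sub>v 0\<^sub>v k) = (A x *\<^sub>v v) @\<^sub>v 0\<^sub>v k" if "x \<in> I" for x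
      unfolding SA[OF that] dsum_mult_vec[OF Ac[OF that] one_carrier_mat v zero_carrier_vec]
      by (simp only: one_mult_mat_vec[OF zero_carrier_vec])
    have "cong_mat W (S x) *\<^sub>v (v @\<^sub>v 0\<^sub>v k) = 0\<^sub>v n"
      unfolding mult[OF x] z zero_vec_append rk ..
    then have "S x *\<^sub>v (W *\<^sub>v (v @\<^sub>v 0\<^sub>v k)) = 0\<^sub>v n"
      unfolding cong_mat_kernel[OF W Sc[OF x] e] .
    then have "S y *\<^sub>v (W *\<^sub>v (v @\<^sub>v 0\<^sub>v k)) = 0\<^sub>v n"
      by (rule ker[OF x y mult_mat_vec_carrier[OF Wc e]])
    then have "(A y *\<^sub>v v) @\<^sub>v 0\<^sub>v k = 0\<^sub>v (r + k)"
      unfolding cong_mat_kernel[OF W Sc[OF y] e, symmetric] mult[OF y] rk .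
    then show ?thesis by (rule append_vec_zeroD(1)[OF mult_mat_vec_carrier[OF Ac[OF y] v]])
  qed
  have "\<exists>s z U Q. s + z = r \<and> nonsing r U \<and>
    (\<forall>x\<in>I. spd_mat s (Q x) \<and> cong_mat U (A x) = dsum (Q x) (0\<^sub>m z z))"
    by (rule common_kernel_reduction[of x0 I r A]) (fact I, fact psdA, fact kerA)
  then obtain s z U Q where sz: "s + z = r" and U: "nonsing r U"
    and Q: "\<forall>x\<in>I. spd_mat s (Q x) \<and> cong_mat U (A x) = dsum (Q x) (0\<^sub>m z z)"
    by blast
  note Uc = nonsing_carrier[OF U]
  have spdG: "spd_mat (s + z) (cong_mat U (1\<^sub>m r))"
    unfolding sz by (rule spd_mat_cong[OF Uc spd_mat_one nonsing_inj[OF U]])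
  then have Gc: "cong_mat U (1\<^sub>m r) \<in> carrier_mat (s + z) (s + z)"
    and Gs: "transpose_mat (cong_mat U (1\<^sub>m r)) = cong_mat U (1\<^sub>m r)"
    unfolding spd_mat_def by blast+
  obtain G1 G2 G3 where G1: "G1 \<in> carrier_mat s s" and G2: "G2 \<in> carrier_mat s z"
    and G3: "G3 \<in> carrier_mat z z" and "transpose_mat G1 = G1" and G3s: "transpose_mat G3 = G3"
    and G: "cong_mat U (1\<^sub>m r) = four_block_mat G1 G2 (transpose_mat G2) G3"
    by (rule symmetric_split[OF Gc Gs])
  from schur_reduction[OF G2 spd_mat_lower_block[OF G1 G2 G3 G3s spdG[unfolded G]]]
  obtain V H where V: "nonsing (s + z) V" and H: "H \<in> carrier_mat s s"
    and VA: "\<And>A. A \<in> carrier_mat s s \<Longrightarrow>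
       cong_mat V (four_block_mat A G2 (transpose_mat G2) G3) = dsum (A - H) (1\<^sub>m z)"
    and VZ: "\<And>Z. Z \<in> carrier_mat s s \<Longrightarrow> cong_mat V (dsum Z (0\<^sub>m z z)) = dsum Z (0\<^sub>m z z)"
    by blast
  let ?E = "G1 - H"
  have Eh: "?E \<in> carrier_mat s s" by (rule minus_carrier_mat[OF H])
  have VG: "cong_mat V (cong_mat U (1\<^sub>m r)) = dsum ?E (1\<^sub>m z)" unfolding G by (rule VA[OF G1])
  have "spd_mat (s + z) (dsum ?E (1\<^sub>m z))"
    unfolding VG[symmetric] by (rule spd_mat_cong[OF nonsing_carrier[OF V] spdG nonsing_inj[OF V]])
  then have spdE: "spd_mat s ?E" by (rule spd_mat_dsumD[OF Eh one_carrier_mat])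
  note V' = V[unfolded sz]
  note Vc = nonsing_carrier[OF V']
  have UV: "nonsing r (U * V)" by (rule nonsing_mult[OF U V'])
  let ?T = "dsum (U * V) (1\<^sub>m k)"
  have T: "nonsing n ?T" using nonsing_dsum[OF UV nonsing_one[of k]] unfolding rk .
  have WT: "nonsing n (W * ?T)" by (rule nonsing_mult[OF W T])
  have one: "cong_mat (1\<^sub>m k) M = M" if "M \<in> carrier_mat k k" for M
    using that unfolding cong_mat_def by simp
  have "cong_mat (W * ?T) E = dsum (dsum ?E (1\<^sub>m z)) (0\<^sub>m k k)"
    unfolding cong_mat_comp[OF Wc nonsing_carrier[OF T] Ec, symmetric] WE
      cong_mat_dsum[OF nonsing_carrier[OF UV] one_carrier_mat one_carrier_mat zero_carrier_mat]
      cong_mat_comp[OF Uc Vc one_carrier_mat, symmetric] VG one[OF zero_carrier_mat] ..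
  moreover have "cong_mat (W * ?T) (S x) = dsum (dsum (Q x) (0\<^sub>m z z)) (1\<^sub>m k)" if x: "x \<in> I" for x
  proof -
    have "Q x \<in> carrier_mat s s" using Q x unfolding spd_mat_def by blast
    note VQ = VZ[OF this]
    have UA: "cong_mat U (A x) = dsum (Q x) (0\<^sub>m z z)" using Q x by blast
    show ?thesis
      unfolding cong_mat_comp[OF Wc nonsing_carrier[OF T] Sc[OF x], symmetric] SA[OF x]
        cong_mat_dsum[OF nonsing_carrier[OF UV] one_carrier_mat Ac[OF x] one_carrier_mat]
        cong_mat_comp[OF Uc Vc Ac[OF x], symmetric] UA VQ one[OF one_carrier_mat] ..
  qed
  moreover have "s + z + k = n" using sz rk by simp
  ultimately show ?thesis using WT spdE Q by blast
qed

section \<open>Definite matrices and their kernels\<close>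

lemma spd_mat_dsum:
  assumes A: "spd_mat n A" and B: "spd_mat m B"
  shows "spd_mat (n + m) (dsum A B)"
proof -
  have Ac: "A \<in> carrier_mat n n" "transpose_mat A = A" and Bc: "B \<in> carrier_mat m m" "transpose_mat B = B"
    using A B unfolding spd_mat_def by blast+
  note psdA = spd_imp_psd[OF A] and psdB = spd_imp_psd[OF B]
  show ?thesis unfolding spd_mat_def
  proof (intro conjI ballI impI)
    show "dsum A B \<in> carrier_mat (n + m) (n + m)" by (rule dsum_carrier[OF Ac(1) Bc(1)])
    show "transpose_mat (dsum A B) = dsum A B"
      unfolding dsum_eq[OF Ac(1) Bc(1)]
        transpose_four_block_mat[OF Ac(1) zero_carrier_mat zero_carrier_mat Bc(1)] Ac(2) Bc(2) by simp
    fix v :: "real Matrix.vec" assume v: "v \<in> carrier_vec (n + m)" "v \<noteq> 0\<^sub>v (n + m)"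
    define a b where "a = vec_first v n" and "b = vec_last v m"
    have ab: "a \<in> carrier_vec n" "b \<in> carrier_vec m" and vab: "v = a @\<^sub>v b"
      using vec_first_last_append[OF v(1)] unfolding a_def b_def by auto
    have "v \<bullet> (dsum A B *\<^sub>v v) = a \<bullet> (A *\<^sub>v a) + b \<bullet> (B *\<^sub>v b)"
      unfolding vab dsum_mult_vec[OF Ac(1) Bc(1) ab]
      by (rule scalar_prod_append[OF ab mult_mat_vec_carrier[OF Ac(1) ab(1)] mult_mat_vec_carrier[OF Bc(1) ab(2)]])
    moreover have "a \<bullet> (A *\<^sub>v a) \<ge> 0" "b \<bullet> (B *\<^sub>v b) \<ge> 0"
      using psdA psdB ab unfolding psd_mat_def by blast+
    moreover have "a \<noteq> 0\<^sub>v n \<or> b \<noteq> 0\<^sub>v m" using v(2) unfolding vab zero_vec_append[symmetric] by blast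
    then have "a \<bullet> (A *\<^sub>v a) > 0 \<or> b \<bullet> (B *\<^sub>v b) > 0"
      using A B ab unfolding spd_mat_def by blast
    ultimately show "v \<bullet> (dsum A B *\<^sub>v v) > 0" by linarith
  qed
qed

text \<open>The inverse \<open>B\<close> of \<open>R\<close> is congruent to \<open>R\<close>, since \<open>B = B\<^sup>T R B\<close>.\<close>

lemma spd_mat_inverse:
  assumes R: "spd_mat n R" shows "spd_mat n (the (mat_inverse R))"
proof -
  note nR = spd_mat_nonsing[OF R]
  note Rc = nonsing_carrier[OF nR]
  have Rs: "transpose_mat R = R" using R unfolding spd_mat_def by blast
  have "mat_inverse R \<noteq> None"
    using mat_inverse(1)[OF Rc, of "()"] det_non_zero_imp_unit[OF Rc, of "()"] nR unfolding nonsing_def by blast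
  then obtain B where RB: "mat_inverse R = Some B" by blast
  from mat_inverse(2)[OF Rc RB] have inv: "R * B = 1\<^sub>m n" "B * R = 1\<^sub>m n" and B: "B \<in> carrier_mat n n" by auto
  have BT: "transpose_mat B \<in> carrier_mat n n" using B by simp
  have "transpose_mat B * R = 1\<^sub>m n"
    using arg_cong[OF inv(1), of transpose_mat] unfolding transpose_mult[OF Rc B] Rs by simp
  then have "cong_mat B R = B" unfolding cong_mat_def using B by simp
  moreover have "nonsing n B"
  proof -
    have "Determinant.det R * Determinant.det B = 1" unfolding det_mult[OF Rc B, symmetric] inv by simp
    then show ?thesis using B unfolding nonsing_def by auto
  qed
  then have "spd_mat n (cong_mat B R)" by (rule spd_mat_cong[OF B R nonsing_inj])
  ultimately show ?thesis unfolding RB by simp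
qed

lemma cong_spd_kernel:
  assumes W: "W \<in> carrier_mat n m" and M: "spd_mat n M" and v: "v \<in> carrier_vec m"
  shows "cong_mat W M *\<^sub>v v = 0\<^sub>v m \<longleftrightarrow> W *\<^sub>v v = 0\<^sub>v n"
proof
  have Mc: "M \<in> carrier_mat n n" using M unfolding spd_mat_def by blast
  have Wv: "W *\<^sub>v v \<in> carrier_vec n" by (rule mult_mat_vec_carrier[OF W v])
  { assume "cong_mat W M *\<^sub>v v = 0\<^sub>v m"
    then have "(W *\<^sub>v v) \<bullet> (M *\<^sub>v (W *\<^sub>v v)) = 0"
      unfolding cong_mat_form[OF W Mc v, symmetric] using v by simp
    then show "W *\<^sub>v v = 0\<^sub>v n" using M Wv unfolding spd_mat_def by force }
  assume z: "W *\<^sub>v v = 0\<^sub>v n"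
  have WT: "transpose_mat W \<in> carrier_mat m n" using W by simp
  show "cong_mat W M *\<^sub>v v = 0\<^sub>v m"
    unfolding cong_mat_mult_vec[OF W Mc v] z mult_zero_vec[OF Mc] by (rule mult_zero_vec[OF WT])
qed

section \<open>The reduced matrices in factored form\<close>

lemma basis_mat_inj:
  assumes Y: "basis_mat n Y S" and Yc: "Y \<in> carrier_mat n q" and w: "w \<in> carrier_vec q"
    and z: "Y *\<^sub>v w = 0\<^sub>v n"
  shows "w = 0\<^sub>v q"
proof (rule ccontr)
  assume "w \<noteq> 0\<^sub>v q"
  then have "module.lin_dep class_ring (module_vec TYPE(real) n) (set (cols Y))"
    using vec_space.lin_depI[OF Yc w _ z] Y unfolding basis_mat_def by blast
  then show False using Y unfolding basis_mat_def by blast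
qed

lemma basis_mat_range:
  assumes Y: "basis_mat n Y (vec_space.col_space n A)" and Yc: "Y \<in> carrier_mat n q"
    and A: "A \<in> carrier_mat n p" and w: "w \<in> carrier_vec q"
  obtains u where "u \<in> carrier_vec p" "Y *\<^sub>v w = A *\<^sub>v u"
proof -
  have "vec_space.col_space n Y = vec_space.col_space n A"
    using Y unfolding basis_mat_def vec_space.col_space_def by blast
  moreover have "Y *\<^sub>v w \<in> vec_space.col_space n Y"
    unfolding vec_space.col_space_eq[OF Yc] using Yc w by auto
  ultimately have "\<exists>u\<in>carrier_vec p. A *\<^sub>v u = Y *\<^sub>v w"
    using A unfolding vec_space.col_space_eq[OF A] by auto
  then show thesis using that by metis
qed

text \<open>The kernel of \<open>C\<close> and the range of \<open>C\<^sup>T\<close> are orthogonal.\<close>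

lemma kernel_meets_coimage_trivially:
  fixes C :: "real Matrix.mat"
  assumes C: "C \<in> carrier_mat p n" and u: "u \<in> carrier_vec p"
    and z: "C *\<^sub>v (transpose_mat C *\<^sub>v u) = 0\<^sub>v p"
  shows "transpose_mat C *\<^sub>v u = 0\<^sub>v n"
proof -
  define y where "y = transpose_mat C *\<^sub>v u"
  have y: "y \<in> carrier_vec n" unfolding y_def using C u by auto
  have "y \<bullet> y = u \<bullet> (C *\<^sub>v y)"
    using transpose_vec_mult_scalar[OF C y u] unfolding y_def .
  also have "\<dots> = 0" using z u unfolding y_def by simp
  finally show ?thesis using conjugate_square_eq_0_vec[OF y] unfolding y_def by simp
qed

text \<open>Maps reduced coefficients \<open>(a\<^sub>1, a\<^sub>2\<^sub>1)\<close> to the edge coefficients \<open>(a\<^sub>1, Y a\<^sub>2\<^sub>1)\<close>.\<close>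

definition basis_extension :: "mqs \<Rightarrow> real Matrix.mat \<Rightarrow> real Matrix.mat" where
  "basis_extension P Y = four_block_mat (1\<^sub>m (n1 P)) (0\<^sub>m (n1 P) (n2 P - k2 P))
     (0\<^sub>m (n2 P) (n1 P)) Y"

lemma mqs_mat_carriers:
  shows "C1 P \<in> carrier_mat (nf P) (n1 P)" "C2 P \<in> carrier_mat (nf P) (n2 P)"
    "C_d P \<in> carrier_mat (nf P) (ne P)" "X1 P \<in> carrier_mat (n1 P) (coils P)"
    "X2 P \<in> carrier_mat (n2 P) (coils P)"
  unfolding C1_def C2_def C_d_def X1_def X2_def by simp_all

lemma C_d_append:
  assumes a: "a \<in> carrier_vec (n1 P)" and b: "b \<in> carrier_vec (n2 P)"
  shows "C_d P *\<^sub>v (a @\<^sub>v b) = C1 P *\<^sub>v a + C2 P *\<^sub>v b"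
proof (rule eq_vecI)
  fix i assume "i < dim_vec (C1 P *\<^sub>v a + C2 P *\<^sub>v b)"
  then have i: "i < nf P" using mqs_mat_carriers(2)[of P] by auto
  have "row (C_d P) i = row (C1 P) i @\<^sub>v row (C2 P) i"
    using i by (intro eq_vecI) (auto simp: C1_def C2_def C_d_def)
  moreover have "row (C1 P) i \<in> carrier_vec (n1 P)" "row (C2 P) i \<in> carrier_vec (n2 P)"
    using mqs_mat_carriers(1,2)[of P] unfolding carrier_vec_def by auto
  ultimately show "(C_d P *\<^sub>v (a @\<^sub>v b)) $ i = (C1 P *\<^sub>v a + C2 P *\<^sub>v b) $ i"
    using i a b mqs_mat_carriers(1,2,3)[of P] by (simp add: scalar_prod_append[of _ "n1 P" _ "n2 P"])
qed (use mqs_mat_carriers(2,3)[of P] in auto)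

context
  fixes P :: mqs and Y :: "real Matrix.mat"
  assumes Yc: "Y \<in> carrier_mat (n2 P) (n2 P - k2 P)"
begin

lemma basis_extension_carrier: "basis_extension P Y \<in> carrier_mat (ne P) (nr P)"
  unfolding basis_extension_def using Yc by simp

lemma basis_extension_mult:
  assumes a: "a \<in> carrier_vec (n1 P)" and b: "b \<in> carrier_vec (n2 P - k2 P)"
  shows "basis_extension P Y *\<^sub>v (a @\<^sub>v b) = a @\<^sub>v (Y *\<^sub>v b)"
proof -
  have "basis_extension P Y *\<^sub>v (a @\<^sub>v b) = (1\<^sub>m (n1 P) *\<^sub>v a + 0\<^sub>m (n1 P) (n2 P - k2 P) *\<^sub>v b)
      @\<^sub>v (0\<^sub>m (n2 P) (n1 P) *\<^sub>v a + Y *\<^sub>v b)"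
    unfolding basis_extension_def
    by (rule four_block_mat_mult_vec[OF one_carrier_mat zero_carrier_mat zero_carrier_mat Yc a b])
  also have "0\<^sub>m (n1 P) (n2 P - k2 P) *\<^sub>v b = 0\<^sub>v (n1 P)" using b by auto
  also have "0\<^sub>m (n2 P) (n1 P) *\<^sub>v a = 0\<^sub>v (n2 P)" using a by auto
  finally show ?thesis using a mult_mat_vec_carrier[OF Yc b] by simp
qed

text \<open>Thus every argument at which the reduced system evaluates \<open>M_nu\<close> is a discrete curl, which is where
  that matrix is known to be definite and to factor the stiffness matrix.\<close>

lemma F_nu_transpose: "transpose_mat (F_nu P Y) = C_d P * basis_extension P Y"
proof (rule mat_eqI_mult_vec)
  have c: "transpose_mat (C1 P) \<in> carrier_mat (n1 P) (nf P)"
    "transpose_mat Y * transpose_mat (C2 P) \<in> carrier_mat (n2 P - k2 P) (nf P)"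
    using mqs_mat_carriers(1,2)[of P] Yc by auto
  then show FT: "transpose_mat (F_nu P Y) \<in> carrier_mat (nf P) (nr P)"
    unfolding F_nu_def by simp
  show "C_d P * basis_extension P Y \<in> carrier_mat (nf P) (nr P)"
    by (rule mult_carrier_mat[OF mqs_mat_carriers(3) basis_extension_carrier])
  have CY: "C2 P * Y \<in> carrier_mat (nf P) (n2 P - k2 P)" by (rule mult_carrier_mat[OF mqs_mat_carriers(2) Yc])
  have F: "transpose_mat (F_nu P Y) = four_block_mat (C1 P) (C2 P * Y) (0\<^sub>m 0 (n1 P)) (0\<^sub>m 0 (n2 P - k2 P))"
  proof -
    have eq: "transpose_mat Y * transpose_mat (C2 P) = transpose_mat (C2 P * Y)"
      by (rule transpose_mult[OF mqs_mat_carriers(2) Yc, symmetric])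
    show ?thesis
      unfolding F_nu_def append_rows_def eq using mqs_mat_carriers(1)[of P] CY
      by (subst transpose_four_block_mat[of _ "n1 P" "nf P" _ 0 _ "n2 P - k2 P"]) auto
  qed
  fix v :: "real Matrix.vec" assume v: "v \<in> carrier_vec (nr P)"
  define a b where "a = vec_first v (n1 P)" and "b = vec_last v (n2 P - k2 P)"
  have a: "a \<in> carrier_vec (n1 P)" and b: "b \<in> carrier_vec (n2 P - k2 P)" and v: "v = a @\<^sub>v b"
    using vec_first_last_append[OF v] unfolding a_def b_def by auto
  have "transpose_mat (F_nu P Y) *\<^sub>v v = (C1 P *\<^sub>v a + C2 P * Y *\<^sub>v b)
      @\<^sub>v (0\<^sub>m 0 (n1 P) *\<^sub>v a + 0\<^sub>m 0 (n2 P - k2 P) *\<^sub>v b)"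
    unfolding F v by (rule four_block_mat_mult_vec[OF mqs_mat_carriers(1) CY zero_carrier_mat zero_carrier_mat a b])
  also have "\<dots> = C1 P *\<^sub>v a + C2 P * Y *\<^sub>v b"
    by (intro eq_vecI) auto
  also have "C2 P * Y *\<^sub>v b = C2 P *\<^sub>v (Y *\<^sub>v b)"
    by (rule assoc_mult_mat_vec[OF mqs_mat_carriers(2) Yc b])
  also have "C1 P *\<^sub>v a + C2 P *\<^sub>v (Y *\<^sub>v b) = C_d P *\<^sub>v (basis_extension P Y *\<^sub>v v)"
    unfolding v basis_extension_mult[OF a b] C_d_append[OF a mult_mat_vec_carrier[OF Yc b]] ..
  also have "\<dots> = C_d P * basis_extension P Y *\<^sub>v v"
    by (rule assoc_mult_mat_vec[OF mqs_mat_carriers(3) basis_extension_carrier, symmetric])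
       (use v a b in auto)
  finally show "transpose_mat (F_nu P Y) *\<^sub>v v = C_d P * basis_extension P Y *\<^sub>v v" .
qed

lemma A_r_factored: 
  "- A_r P Y x = cong_mat (C_d P * basis_extension P Y) (M_nu P (C_d P * basis_extension P Y *\<^sub>v x))"
  unfolding A_r_def cong_mat_def F_nu_transpose[symmetric] by simp

lemma F_sigma_carrier: "transpose_mat (F_sigma P Y) \<in> carrier_mat (n1 P + coils P) (nr P)"
proof -
  have "transpose_mat Y * X2 P \<in> carrier_mat (n2 P - k2 P) (coils P)"
    using Yc mqs_mat_carriers(5)[of P] by auto
  then show ?thesis unfolding F_sigma_def by simp
qed

lemma E_r_factored: "E_r P Y = cong_mat (transpose_mat (F_sigma P Y)) (M_sigma_R P)"
  unfolding E_r_def cong_mat_def by simp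

text \<open>The identity block of \<open>F_sigma\<close> forces the conducting part of a kernel vector to vanish.\<close>

lemma F_sigma_transpose_kernel:
  assumes a: "a \<in> carrier_vec (n1 P)" and b: "b \<in> carrier_vec (n2 P - k2 P)"
    and z: "transpose_mat (F_sigma P Y) *\<^sub>v (a @\<^sub>v b) = 0\<^sub>v (n1 P + coils P)"
  shows "a = 0\<^sub>v (n1 P)"
proof -
  let ?Z = "transpose_mat Y * X2 P"
  have Z: "?Z \<in> carrier_mat (n2 P - k2 P) (coils P)" using Yc mqs_mat_carriers(5)[of P] by auto
  have c: "transpose_mat (X1 P) \<in> carrier_mat (coils P) (n1 P)" "transpose_mat ?Z \<in> carrier_mat (coils P) (n2 P - k2 P)"
    using Z mqs_mat_carriers(4)[of P] by auto
  have "transpose_mat (F_sigma P Y) = four_block_mat (1\<^sub>m (n1 P)) (0\<^sub>m (n1 P) (n2 P - k2 P)) (transpose_mat (X1 P)) (transpose_mat ?Z)"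
    unfolding F_sigma_def transpose_four_block_mat[OF one_carrier_mat mqs_mat_carriers(4) zero_carrier_mat Z] by simp
  then have "transpose_mat (F_sigma P Y) *\<^sub>v (a @\<^sub>v b) =
      (1\<^sub>m (n1 P) *\<^sub>v a + 0\<^sub>m (n1 P) (n2 P - k2 P) *\<^sub>v b) @\<^sub>v (transpose_mat (X1 P) *\<^sub>v a + transpose_mat ?Z *\<^sub>v b)"
    using four_block_mat_mult_vec[OF one_carrier_mat zero_carrier_mat c a b] by simp
  also have "0\<^sub>m (n1 P) (n2 P - k2 P) *\<^sub>v b = 0\<^sub>v (n1 P)" using b by auto
  also have "1\<^sub>m (n1 P) *\<^sub>v a + 0\<^sub>v (n1 P) = a" using a by simp
  finally show ?thesis using z append_vec_zeroD(1)[OF a] by metis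
qed

end

lemma M_sigma_R_spd:
  assumes M: "spd_mat (n1 P) (M11 P)" and R: "spd_mat (coils P) (Res P)"
  shows "spd_mat (n1 P + coils P) (M_sigma_R P)"
proof -
  note Ri = spd_mat_inverse[OF R]
  have "M11 P \<in> carrier_mat (n1 P) (n1 P)" "the (mat_inverse (Res P)) \<in> carrier_mat (coils P) (coils P)"
    using M Ri unfolding spd_mat_def by blast+
  from dsum_eq[OF this] show ?thesis using spd_mat_dsum[OF M Ri] unfolding M_sigma_R_def by simp
qed

theorem theorem6:
  fixes P :: mqs and Y :: "real Matrix.mat"
    and K11 :: "real Matrix.vec \<Rightarrow> real Matrix.mat" and K12 K22 :: "real Matrix.mat"
  assumes domain: "mqs_domain P"
    and data: "mqs_data P"
    and mesh: "mqs_mesh P"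
    and K_factor: "\<And>a. a \<in> carrier_vec (ne P) \<Longrightarrow>
           K P a = transpose_mat (C_d P) * M_nu P (C_d P *\<^sub>v a) * C_d P"
    and X_factor: "X P = transpose_mat (C_d P) * Upsilon P"
    and M_nu_spd: "\<And>a. a \<in> carrier_vec (ne P) \<Longrightarrow> spd_mat (nf P) (M_nu P (C_d P *\<^sub>v a))"
    and M_sigma_block: "M_sigma P = four_block_mat (M11 P) (0\<^sub>m (n1 P) (n2 P)) (0\<^sub>m (n2 P) (n1 P)) (0\<^sub>m (n2 P) (n2 P))"
    and M11_spd: "spd_mat (n1 P) (M11 P)"
    and K11_dim: "\<And>a1. a1 \<in> carrier_vec (n1 P) \<Longrightarrow> K11 a1 \<in> carrier_mat (n1 P) (n1 P)"
    and K12_dim: "K12 \<in> carrier_mat (n1 P) (n2 P)"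
    and K22_dim: "K22 \<in> carrier_mat (n2 P) (n2 P)"
    and K_block: "\<And>a1 a2. a1 \<in> carrier_vec (n1 P) \<Longrightarrow> a2 \<in> carrier_vec (n2 P) \<Longrightarrow>
           K P (a1 @\<^sub>v a2) = four_block_mat (K11 a1) K12 (transpose_mat K12) K22"
    and X2_rank: "vec_space.rank (n2 P) (X2 P) = coils P"
    and Y_dim: "Y \<in> carrier_mat (n2 P) (n2 P - k2 P)"
    and Y_basis: "basis_mat (n2 P) Y (vec_space.col_space (n2 P) (transpose_mat (C2 P)))"
  shows "\<exists>W ns n0 ninf E11 A11.
    W \<in> carrier_mat (nr P) (nr P) \<and> invertible_mat W \<and> ns + n0 + ninf = nr P \<and>
    spd_mat ns E11 \<and>
    transpose_mat W * E_r P Y * W = diag_block_mat [E11, 1\<^sub>m n0, 0\<^sub>m ninf ninf] \<and>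
    (\<forall>x\<in>carrier_vec (nr P).
       spd_mat ns (- A11 x) \<and>
       transpose_mat W * A_r P Y x * W = diag_block_mat [A11 x, 0\<^sub>m n0 n0, - 1\<^sub>m ninf])"
proof -
  let ?B = "basis_extension P Y" and ?I = "carrier_vec (nr P) :: real Matrix.vec set"
  let ?F = "C_d P * ?B" and ?S = "\<lambda>x. - A_r P Y x" and ?q = "n2 P - k2 P"
  note Bc = basis_extension_carrier[OF Y_dim]
  have Fc: "?F \<in> carrier_mat (nf P) (nr P)" by (rule mult_carrier_mat[OF mqs_mat_carriers(3) Bc])
  have Fx: "?F *\<^sub>v x = C_d P *\<^sub>v (?B *\<^sub>v x)" if "x \<in> ?I" for x
    by (rule assoc_mult_mat_vec[OF mqs_mat_carriers(3) Bc that])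
  have Bx: "?B *\<^sub>v x \<in> carrier_vec (ne P)" if "x \<in> ?I" for x by (rule mult_mat_vec_carrier[OF Bc that])
  have Mx: "spd_mat (nf P) (M_nu P (?F *\<^sub>v x))" if "x \<in> ?I" for x
    unfolding Fx[OF that] by (rule M_nu_spd[OF Bx[OF that]])
  have Mxc: "M_nu P (?F *\<^sub>v x) \<in> carrier_mat (nf P) (nf P)" if "x \<in> ?I" for x
    using Mx[OF that] unfolding spd_mat_def by blast
  note S = A_r_factored[OF Y_dim]
  have M\<sigma>: "spd_mat (n1 P + coils P) (M_sigma_R P)"
    using M11_spd data unfolding mqs_data_def by (intro M_sigma_R_spd) blast+
  note E = E_r_factored[OF Y_dim]
  note F\<sigma> = F_sigma_carrier[OF Y_dim]
  have psdE: "psd_mat (nr P) (E_r P Y)" unfolding E by (rule psd_mat_cong[OF F\<sigma> spd_imp_psd[OF M\<sigma>]])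
  have psdS: "psd_mat (nr P) (?S x)" if "x \<in> ?I" for x
    unfolding S by (rule psd_mat_cong[OF Fc spd_imp_psd[OF Mx[OF that]]])
  have kerS: "?S x *\<^sub>v v = 0\<^sub>v (nr P) \<longleftrightarrow> ?F *\<^sub>v v = 0\<^sub>v (nf P)" if "x \<in> ?I" "v \<in> carrier_vec (nr P)" for x v
    unfolding S by (rule cong_spd_kernel[OF Fc Mx[OF that(1)] that(2)])
  (* On the kernel of E_r the conducting coefficients vanish. *)
  have kerE: "\<exists>w\<in>carrier_vec ?q. v = 0\<^sub>v (n1 P) @\<^sub>v w"
    if v: "v \<in> carrier_vec (nr P)" and z: "E_r P Y *\<^sub>v v = 0\<^sub>v (nr P)" for v
  proof -
    define a b where "a = vec_first v (n1 P)" and "b = vec_last v ?q"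
    have a: "a \<in> carrier_vec (n1 P)" and b: "b \<in> carrier_vec ?q" and vab: "v = a @\<^sub>v b"
      using vec_first_last_append[OF v] unfolding a_def b_def by auto
    have "transpose_mat (F_sigma P Y) *\<^sub>v v = 0\<^sub>v (n1 P + coils P)"
      using z unfolding E cong_spd_kernel[OF F\<sigma> M\<sigma> v] .
    then have "a = 0\<^sub>v (n1 P)" unfolding vab by (rule F_sigma_transpose_kernel[OF Y_dim a b])
    with b vab show ?thesis by blast
  qed
  have Bw: "?B *\<^sub>v (0\<^sub>v (n1 P) @\<^sub>v w) = 0\<^sub>v (n1 P) @\<^sub>v (Y *\<^sub>v w)" if "w \<in> carrier_vec ?q" for w
    by (rule basis_extension_mult[OF Y_dim zero_carrier_vec that])
  (* The nonlinear block K11 is multiplied by the vanishing conducting part, so the result is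
     independent of x. *)
  have Sw: "?S x *\<^sub>v (0\<^sub>v (n1 P) @\<^sub>v w) = transpose_mat ?B *\<^sub>v ((K12 *\<^sub>v (Y *\<^sub>v w)) @\<^sub>v (K22 *\<^sub>v (Y *\<^sub>v w)))"
    if x: "x \<in> ?I" and w: "w \<in> carrier_vec ?q" for x w
  proof -
    define a b where "a = vec_first x (n1 P)" and "b = vec_last x ?q"
    have a: "a \<in> carrier_vec (n1 P)" and b: "b \<in> carrier_vec ?q" and xab: "x = a @\<^sub>v b"
      using vec_first_last_append[OF x] unfolding a_def b_def by auto
    have Yb: "Y *\<^sub>v b \<in> carrier_vec (n2 P)" and Yw: "Y *\<^sub>v w \<in> carrier_vec (n2 P)"
      using mult_mat_vec_carrier[OF Y_dim] b w by auto
    have K12T: "transpose_mat K12 \<in> carrier_mat (n2 P) (n1 P)" using K12_dim by simp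
    have Kx: "cong_mat (C_d P) (M_nu P (?F *\<^sub>v x)) = four_block_mat (K11 a) K12 (transpose_mat K12) K22"
      unfolding K_block[OF a Yb, symmetric] cong_mat_def Fx[OF x]
      using K_factor[OF Bx[OF x]] basis_extension_mult[OF Y_dim a b] unfolding xab by simp
    have Kc: "cong_mat (C_d P) (M_nu P (?F *\<^sub>v x)) \<in> carrier_mat (ne P) (ne P)"
      by (rule cong_mat_carrier[OF mqs_mat_carriers(3) Mxc[OF x]])
    have "?S x *\<^sub>v (0\<^sub>v (n1 P) @\<^sub>v w) = transpose_mat ?B *\<^sub>v (cong_mat (C_d P) (M_nu P (?F *\<^sub>v x)) *\<^sub>v (?B *\<^sub>v (0\<^sub>v (n1 P) @\<^sub>v w)))"
      unfolding S cong_mat_comp[OF mqs_mat_carriers(3) Bc Mxc[OF x], symmetric]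
      by (rule cong_mat_mult_vec[OF Bc Kc append_carrier_vec[OF zero_carrier_vec w]])
    then show ?thesis
      unfolding Bw[OF w] Kx four_block_mult_lower[OF K11_dim[OF a] K12_dim K12T K22_dim Yw] .
  qed
  have const: "?S x *\<^sub>v v = ?S y *\<^sub>v v"
    if "x \<in> ?I" "y \<in> ?I" "v \<in> carrier_vec (nr P)" "E_r P Y *\<^sub>v v = 0\<^sub>v (nr P)" for x y v
    using kerE[OF that(3,4)] Sw[OF that(1)] Sw[OF that(2)] by metis
  have regular: "v = 0\<^sub>v (nr P)"
    if x: "x \<in> ?I" and v: "v \<in> carrier_vec (nr P)" and Ev: "E_r P Y *\<^sub>v v = 0\<^sub>v (nr P)"
      and Sv: "?S x *\<^sub>v v = 0\<^sub>v (nr P)" for x v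
  proof -
    obtain w where w: "w \<in> carrier_vec ?q" and vw: "v = 0\<^sub>v (n1 P) @\<^sub>v w"
      using kerE[OF v Ev] by blast
    have Yw: "Y *\<^sub>v w \<in> carrier_vec (n2 P)" by (rule mult_mat_vec_carrier[OF Y_dim w])
    have CYw: "C2 P *\<^sub>v (Y *\<^sub>v w) \<in> carrier_vec (nf P)" by (rule mult_mat_vec_carrier[OF mqs_mat_carriers(2) Yw])
    have "?F *\<^sub>v v = 0\<^sub>v (nf P)" using Sv unfolding kerS[OF x v] .
    then have z: "C2 P *\<^sub>v (Y *\<^sub>v w) = 0\<^sub>v (nf P)"
      unfolding Fx[OF v] unfolding vw Bw[OF w] C_d_append[OF zero_carrier_vec Yw]
        mult_zero_vec[OF mqs_mat_carriers(1)] left_zero_vec[OF CYw] .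
    (* Y w lies both in the kernel of C2 and in the range of its transpose. *)
    have CT: "transpose_mat (C2 P) \<in> carrier_mat (n2 P) (nf P)" using mqs_mat_carriers(2)[of P] by simp
    obtain u where u: "u \<in> carrier_vec (nf P)" and Yu: "Y *\<^sub>v w = transpose_mat (C2 P) *\<^sub>v u"
      by (rule basis_mat_range[OF Y_basis Y_dim CT w])
    have "Y *\<^sub>v w = 0\<^sub>v (n2 P)"
      using kernel_meets_coimage_trivially[OF mqs_mat_carriers(2) u] z unfolding Yu by blast
    then have "w = 0\<^sub>v ?q" by (rule basis_mat_inj[OF Y_basis Y_dim w])
    then show ?thesis unfolding vw zero_vec_append[symmetric] by simp
  qed
  have kerSS: "?S y *\<^sub>v v = 0\<^sub>v (nr P)"
    if "x \<in> ?I" "y \<in> ?I" "v \<in> carrier_vec (nr P)" "?S x *\<^sub>v v = 0\<^sub>v (nr P)" for x y v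
    using that(4) unfolding kerS[OF that(1,3)] kerS[OF that(2,3)] .
  have "\<exists>W ns n0 ninf E11 Q. nonsing (nr P) W \<and> ns + n0 + ninf = nr P \<and> spd_mat ns E11 \<and>
    cong_mat W (E_r P Y) = dsum (dsum E11 (1\<^sub>m n0)) (0\<^sub>m ninf ninf) \<and>
    (\<forall>x\<in>?I. spd_mat ns (Q x) \<and> cong_mat W (?S x) = dsum (dsum (Q x) (0\<^sub>m n0 n0)) (1\<^sub>m ninf))"
    by (rule simultaneous_normal_form[of "0\<^sub>v (nr P)" ?I "nr P" "E_r P Y" ?S])
      (rule zero_carrier_vec, fact psdE, fact psdS, fact kerSS, fact const, fact regular)
  then obtain W ns n0 ninf E11 Q where W: "nonsing (nr P) W" and dims: "ns + n0 + ninf = nr P"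
    and E11: "spd_mat ns E11"
    and WE: "cong_mat W (E_r P Y) = dsum (dsum E11 (1\<^sub>m n0)) (0\<^sub>m ninf ninf)"
    and WS: "\<forall>x\<in>?I. spd_mat ns (Q x) \<and> cong_mat W (?S x) = dsum (dsum (Q x) (0\<^sub>m n0 n0)) (1\<^sub>m ninf)"
    by blast
  note Wc = nonsing_carrier[OF W]
  have WA: "cong_mat W (A_r P Y x) = dsum (dsum (- Q x) (0\<^sub>m n0 n0)) (- 1\<^sub>m ninf)" if x: "x \<in> ?I" for x
  proof -
    have Sc: "?S x \<in> carrier_mat (nr P) (nr P)" using psdS[OF x] unfolding psd_mat_def by blast
    have Qc: "Q x \<in> carrier_mat ns ns" using WS x unfolding spd_mat_def by blast
    have "cong_mat W (A_r P Y x) = cong_mat W (- ?S x)" by simp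
    also have "\<dots> = - cong_mat W (?S x)"
    proof -
      have WT: "transpose_mat W \<in> carrier_mat (nr P) (nr P)" using Wc by simp
      have "transpose_mat W * (- ?S x) = - (transpose_mat W * ?S x)"
        by (rule uminus_mult_right_mat) (use WT Sc in auto)
      moreover have "- (transpose_mat W * ?S x) * W = - (transpose_mat W * ?S x * W)"
        by (rule uminus_mult_left_mat) (use Wc Sc in auto)
      ultimately show ?thesis unfolding cong_mat_def by simp
    qed
    also have "\<dots> = - dsum (dsum (Q x) (0\<^sub>m n0 n0)) (1\<^sub>m ninf)" using WS x by simp
    also have "\<dots> = dsum (dsum (- Q x) (0\<^sub>m n0 n0)) (- 1\<^sub>m ninf)"
      using Qc unfolding dsum_def by (intro eq_matI) auto
    finally show ?thesis .
  qed
  show ?thesis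
  proof (intro exI conjI ballI)
    show "W \<in> carrier_mat (nr P) (nr P)" "invertible_mat W" "ns + n0 + ninf = nr P" "spd_mat ns E11"
      by (fact Wc, rule nonsing_imp_invertible[OF W], fact dims, fact E11)
    show "transpose_mat W * E_r P Y * W = diag_block_mat [E11, 1\<^sub>m n0, 0\<^sub>m ninf ninf]"
      using WE unfolding cong_mat_def diag_block_mat_three .
    fix x :: "real Matrix.vec" assume x: "x \<in> ?I"
    show "spd_mat ns (- (- Q x))" using WS x by simp
    show "transpose_mat W * A_r P Y x * W = diag_block_mat [- Q x, 0\<^sub>m n0 n0, - 1\<^sub>m ninf]"
      using WA[OF x] unfolding cong_mat_def diag_block_mat_three .
  qed
qed

end
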